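(* Let $g:S_1\to S_1$ be an orientation preserving homeomorphism of the circle. Then $(S_1,g)$ is a factor of a finite automaton if and only if its rotation number $\varrho(g)$ is rational.
   Context: $S_1$ is the unit circle in the complex plane, $\theta(x)=\exp(2\pi i x)$ for $x\in\mathbb R$. An increasing continuous map $G:\mathbb R\to\mathbb R$ is a lift of an orientation preserving homeomorphism $g$ if $\theta G=g\theta$. The rotation number $\varrho(g)$ is the fractional part of $\varrho_0(G)=\lim_{n\to\infty}G^n(y)/n$, for any lift $G$ and any $y\in\mathbb R$ (it does not depend on these choices). A dynamical system $(X,f)$ is a continuous map $f:X\to X$ of a compact metric space $X$ to itself. $(Y,g)$ is a factor of $(X,f)$ if there is a continuous surjective map $\varphi:X\to Y$ with $g\varphi=\varphi f$. Finite automata. For a finite alphabet $A$ let $A^{\mathbb N}$ be the set of infinite sequences $u=u_0u_1u_2\ldots$ with $u_i\in A$ and metric $2^{-n}$, $n=\inf\{i\ge 0: u_i\ne v_i\}$. Let $\bullet,\sharp$ be symbols not in the alphabets, and define on $A^{\mathbb N}$: $\sigma_\sharp(u_0u_1u_2\ldots)=u_1u_2u_3\ldots$, $\sigma_\bullet(u)=u$, and $\sigma_a(u_0u_1\ldots)=au_0u_1\ldots$ for $a\in A$. Let $T$ be a finite set (of tapes) and for each $t\in T$ let $A_t$ be a finite alphabet. Put $Q=\prod_{t\in T}A_t$, $X=\prod_{t\in T}A_t^{\mathbb N}$ with a product metric, and $\pi:X\to Q$, $\pi(u)_t=u_{t0}$. The automaton with transition functions $f_t:Q\to A_t\cup\{\bullet,\sharp\}$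 $(t\in T)$ is the dynamical system $(X,f)$ with $f(u)_t=\sigma_{f_t(\pi(u))}(u_t)$ for $u\in X$, $t\in T$. A tape $t$ is an input tape if $f_t(q)\in\{\bullet,\sharp\}$ for all $q\in Q$, and an output tape if $f_t(q)\in A_t\cup\{\bullet\}$ for all $q\in Q$. The automaton is a finite automaton if every tape is an input tape or an output tape. *)

theory Defs
  imports "HOL-Analysis.Analysis"
begin

section \<open>Circle homeomorphisms and their rotation number\<close>

abbreviation unit_circle :: "complex set" where
  "unit_circle \<equiv> sphere 0 1"

definition circle_proj :: "real \<Rightarrow> complex" where
  "circle_proj x = exp (2 * of_real pi * \<i> * of_real x)"

definition is_lift :: "(real \<Rightarrow> real) \<Rightarrow> (complex \<Rightarrow> complex) \<Rightarrow> bool" where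
  "is_lift G g \<longleftrightarrow> continuous_on UNIV G \<and> strict_mono G \<and>
     (\<forall>x. circle_proj (G x) = g (circle_proj x))"

text \<open>Only the restriction of \<open>g\<close> to the circle matters. Preserving the orientation means
  having an increasing lift; orientation reversing homeomorphisms have decreasing lifts.\<close>

definition orientation_preserving_homeo :: "(complex \<Rightarrow> complex) \<Rightarrow> bool" where
  "orientation_preserving_homeo g \<longleftrightarrow>
     (\<exists>h. homeomorphism unit_circle unit_circle g h) \<and> (\<exists>G. is_lift G g)"

definition translation_number :: "(real \<Rightarrow> real) \<Rightarrow> real" where
  "translation_number G = lim (\<lambda>n. (G ^^ n) 0 / real n)"

text \<open>The limit exists and does not depend on the starting point (here 0), and its fractional part
  does not depend on the lift: two lifts of the same map differ by an integer constant.\<close>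

definition rotation_number :: "(complex \<Rightarrow> complex) \<Rightarrow> real" where
  "rotation_number g = frac (translation_number (SOME G. is_lift G g))"


section \<open>Dynamical systems and factors\<close>

definition dynamical_system :: "'a metric \<Rightarrow> ('a \<Rightarrow> 'a) \<Rightarrow> bool" where
  "dynamical_system X f \<longleftrightarrow> compact_space (mtopology_of X) \<and>
     continuous_map (mtopology_of X) (mtopology_of X) f"

definition is_factor :: "'b metric \<Rightarrow> ('b \<Rightarrow> 'b) \<Rightarrow> 'a metric \<Rightarrow> ('a \<Rightarrow> 'a) \<Rightarrow> bool" where
  "is_factor Y g X f \<longleftrightarrow> dynamical_system X f \<and> dynamical_system Y g \<and>
     (\<exists>\<phi>. continuous_map (mtopology_of X) (mtopology_of Y) \<phi> \<and> \<phi> ` mspace X = mspace Y \<and>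
          (\<forall>x\<in>mspace X. g (\<phi> x) = \<phi> (f x)))"

definition circle_metric :: "complex metric" where
  "circle_metric = submetric euclidean_metric unit_circle"


section \<open>Automata\<close>

definition seq_dist :: "(nat \<Rightarrow> 'a) \<Rightarrow> (nat \<Rightarrow> 'a) \<Rightarrow> real" where
  "seq_dist u v = (if u = v then 0 else (1/2) ^ (LEAST i. u i \<noteq> v i))"

text \<open>Configurations are extensional families indexed by the tapes in \<open>T\<close>. Their product metric is
  the sum of the distances on the tapes.\<close>

definition configs :: "'t set \<Rightarrow> ('t \<Rightarrow> 'a set) \<Rightarrow> ('t \<Rightarrow> nat \<Rightarrow> 'a) set" where
  "configs T A = (\<Pi>\<^sub>E t\<in>T. UNIV \<rightarrow> A t)"

definition config_dist :: "'t set \<Rightarrow> ('t \<Rightarrow> nat \<Rightarrow> 'a) \<Rightarrow> ('t \<Rightarrow> nat \<Rightarrow> 'a) \<Rightarrow> real" where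
  "config_dist T u v = (\<Sum>t\<in>T. seq_dist (u t) (v t))"

definition config_metric :: "'t set \<Rightarrow> ('t \<Rightarrow> 'a set) \<Rightarrow> ('t \<Rightarrow> nat \<Rightarrow> 'a) metric" where
  "config_metric T A = metric (configs T A, config_dist T)"

text \<open>\<open>Stay\<close> is the symbol \<open>\<bullet>\<close>, \<open>Drop\<close> is \<open>\<sharp>\<close>, and \<open>Push a\<close> is the letter \<open>a\<close>; a datatype
  makes the two extra symbols distinct from all letters.\<close>

datatype 'a action = Stay | Drop | Push 'a

fun act :: "'a action \<Rightarrow> (nat \<Rightarrow> 'a) \<Rightarrow> (nat \<Rightarrow> 'a)" where
  "act Stay u = u"
| "act Drop u = (\<lambda>i. u (Suc i))"
| "act (Push a) u = case_nat a u"

definition states :: "'t set \<Rightarrow> ('t \<Rightarrow> 'a set) \<Rightarrow> ('t \<Rightarrow> 'a) set" where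
  "states T A = (\<Pi>\<^sub>E t\<in>T. A t)"

definition head :: "'t set \<Rightarrow> ('t \<Rightarrow> nat \<Rightarrow> 'a) \<Rightarrow> ('t \<Rightarrow> 'a)" where
  "head T u = (\<lambda>t\<in>T. u t 0)"

definition automaton ::
  "'t set \<Rightarrow> ('t \<Rightarrow> 'a set) \<Rightarrow> ('t \<Rightarrow> ('t \<Rightarrow> 'a) \<Rightarrow> 'a action) \<Rightarrow> bool" where
  "automaton T A F \<longleftrightarrow> finite T \<and> (\<forall>t\<in>T. finite (A t)) \<and>
     (\<forall>t\<in>T. \<forall>q\<in>states T A. F t q \<in> Push ` A t \<union> {Stay, Drop})"

definition automaton_map ::
  "'t set \<Rightarrow> ('t \<Rightarrow> ('t \<Rightarrow> 'a) \<Rightarrow> 'a action) \<Rightarrow> ('t \<Rightarrow> nat \<Rightarrow> 'a) \<Rightarrow> ('t \<Rightarrow> nat \<Rightarrow> 'a)" where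
  "automaton_map T F u = (\<lambda>t\<in>T. act (F t (head T u)) (u t))"

definition input_tape ::
  "'t set \<Rightarrow> ('t \<Rightarrow> 'a set) \<Rightarrow> ('t \<Rightarrow> ('t \<Rightarrow> 'a) \<Rightarrow> 'a action) \<Rightarrow> 't \<Rightarrow> bool" where
  "input_tape T A F t \<longleftrightarrow> (\<forall>q\<in>states T A. F t q \<in> {Stay, Drop})"

definition output_tape ::
  "'t set \<Rightarrow> ('t \<Rightarrow> 'a set) \<Rightarrow> ('t \<Rightarrow> ('t \<Rightarrow> 'a) \<Rightarrow> 'a action) \<Rightarrow> 't \<Rightarrow> bool" where
  "output_tape T A F t \<longleftrightarrow> (\<forall>q\<in>states T A. F t q \<in> Push ` A t \<union> {Stay})"

definition finite_automaton ::
  "'t set \<Rightarrow> ('t \<Rightarrow> 'a set) \<Rightarrow> ('t \<Rightarrow> ('t \<Rightarrow> 'a) \<Rightarrow> 'a action) \<Rightarrow> bool" where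
  "finite_automaton T A F \<longleftrightarrow> automaton T A F \<and>
     (\<forall>t\<in>T. input_tape T A F t \<or> output_tape T A F t)"

text \<open>Finite sets of tapes and finite alphabets can be encoded as finite sets of natural numbers.\<close>

definition factor_of_finite_automaton :: "'b metric \<Rightarrow> ('b \<Rightarrow> 'b) \<Rightarrow> bool" where
  "factor_of_finite_automaton Y g \<longleftrightarrow>
     (\<exists>(T :: nat set) (A :: nat \<Rightarrow> nat set) F.
        finite_automaton T A F \<and> is_factor Y g (config_metric T A) (automaton_map T F))"


section \<open>The configuration metric is a metric\<close>

lemma seq_dist_le_iff_agree:
  assumes "u \<noteq> v"
  shows "seq_dist u v \<le> (1/2) ^ n \<longleftrightarrow> (\<forall>i<n. u i = v i)"
proof -
  obtain j where j: "u j \<noteq> v j"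
    using assms by auto
  have "(1/2::real) ^ m \<le> (1/2) ^ n \<longleftrightarrow> n \<le> m" for m
    by (simp add: power_decreasing_iff)
  moreover have "n \<le> (LEAST i. u i \<noteq> v i) \<longleftrightarrow> (\<forall>i<n. u i = v i)"
    using LeastI[of "\<lambda>i. u i \<noteq> v i", OF j] not_less_Least[of _ "\<lambda>i. u i \<noteq> v i"]
    by (meson leI order_less_le_trans)
  ultimately show ?thesis
    using assms by (simp add: seq_dist_def)
qed

lemma seq_dist_nonneg [simp]: "0 \<le> seq_dist u v"
  by (simp add: seq_dist_def)

lemma seq_dist_eq_0_iff [simp]: "seq_dist u v = 0 \<longleftrightarrow> u = v"
  by (simp add: seq_dist_def)

lemma seq_dist_commute: "seq_dist u v = seq_dist v u"
  unfolding seq_dist_def by (simp add: eq_commute)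

lemma seq_dist_ultrametric: "seq_dist u w \<le> max (seq_dist u v) (seq_dist v w)"
proof (cases "u = v \<or> v = w \<or> u = w")
  case True
  then show ?thesis
    by (auto simp: seq_dist_def le_max_iff_disj)
next
  case False
  define n where "n = min (LEAST i. u i \<noteq> v i) (LEAST i. v i \<noteq> w i)"
  have "max (seq_dist u v) (seq_dist v w) = (1/2) ^ n"
    using False by (auto simp: seq_dist_def n_def max_def min_def power_decreasing_iff)
  moreover have "\<forall>i<n. u i = w i"
  proof (intro allI impI)
    fix i assume "i < n"
    then have "u i = v i" "v i = w i"
      unfolding n_def by (auto dest: not_less_Least)
    then show "u i = w i"
      by (rule trans)
  qed
  ultimately show ?thesis
    using False seq_dist_le_iff_agree[of u w n] by simp
qed

lemma seq_dist_triangle: "seq_dist u w \<le> seq_dist u v + seq_dist v w"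
  using seq_dist_ultrametric[of u w v] seq_dist_nonneg[of u v] seq_dist_nonneg[of v w] by linarith

lemma Metric_space_configs:
  fixes A :: "'t \<Rightarrow> 'a set"
  assumes "finite T"
  shows "Metric_space (configs T A) (config_dist T)"
proof
  fix u v w :: "'t \<Rightarrow> nat \<Rightarrow> 'a"
  show "0 \<le> config_dist T u v"
    by (simp add: config_dist_def sum_nonneg)
  show "config_dist T u v = config_dist T v u"
    by (simp add: config_dist_def seq_dist_commute)
  show "config_dist T u w \<le> config_dist T u v + config_dist T v w"
    unfolding config_dist_def sum.distrib[symmetric] by (intro sum_mono seq_dist_triangle)
  assume "u \<in> configs T A" "v \<in> configs T A"
  then show "config_dist T u v = 0 \<longleftrightarrow> u = v"
    using assms by (auto simp: config_dist_def configs_def sum_nonneg_eq_0_iff intro: PiE_ext)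
qed

lemma mspace_config_metric: "finite T \<Longrightarrow> mspace (config_metric T A) = configs T A"
  by (simp add: config_metric_def Metric_space.mspace_metric Metric_space_configs)

lemma mdist_config_metric: "finite T \<Longrightarrow> mdist (config_metric T A) = config_dist T"
  by (simp add: config_metric_def Metric_space.mdist_metric Metric_space_configs)

end

theory Submission
  imports Defs
begin

text \<open>If all input tapes are constant, a finite automaton updates its current state autonomously, and
  repeating on every output tape the word pushed during one period of the state gives a periodic
  configuration. So every factor has a periodic point, and on the circle this makes the rotation
  number rational.

  Conversely, if \<open>G\<^sup>q x\<^sub>0 = x\<^sub>0 + p\<close> for a lift \<open>G\<close>, then \<open>H = G\<^sup>q - p\<close> is an increasing
  homeomorphism of \<open>[x\<^sub>0, x\<^sub>0 + 1]\<close>. There is a compact set \<open>K\<close> that meets every orbit of \<open>H\<close> and on which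
  \<open>H\<^sup>n\<close> converges uniformly for \<open>n \<rightarrow> \<infinity>\<close> and for \<open>n \<rightarrow> -\<infinity>\<close>; hence \<open>(y, k) \<mapsto> H\<^sup>k y\<close>
  extends continuously to \<open>K\<close> times the two-point compactification of the integers. A static
  tape codes \<open>K\<close>, an input tape together with an output tape realizes \<open>k \<mapsto> k + 1\<close> on the compactified
  integers, and a counter modulo \<open>q\<close> reduces \<open>G\<close> to \<open>H\<close>.\<close>



section \<open>Lifts and translation numbers\<close>

lemma circle_proj_eq_iff: "circle_proj x = circle_proj y \<longleftrightarrow> x - y \<in> \<int>"
proof -
  have "circle_proj x = circle_proj y \<longleftrightarrow> (\<exists>n::int. x = y + of_int n)"
  proof -
    have "2 * of_real pi * \<i> * of_real x = 2 * of_real pi * \<i> * of_real y + of_int (2 * n) * of_real pi * \<i>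
        \<longleftrightarrow> x = y + of_int n" for n :: int
    proof -
      have "2 * of_real pi * \<i> * complex_of_real x = 2 * of_real pi * \<i> * of_real y + of_int (2 * n) * of_real pi * \<i>
        \<longleftrightarrow> (2 * of_real pi * \<i>) * complex_of_real x = (2 * of_real pi * \<i>) * complex_of_real (y + of_int n)"
        by (simp add: algebra_simps)
      also have "\<dots> \<longleftrightarrow> complex_of_real x = complex_of_real (y + of_int n)"
        by simp
      finally show ?thesis
        by (simp only: of_real_eq_iff)
    qed
    then show ?thesis
      unfolding circle_proj_def exp_eq by simp
  qed
  also have "\<dots> \<longleftrightarrow> x - y \<in> \<int>"
    by (auto elim!: Ints_cases simp: algebra_simps)
  finally show ?thesis .
qed

lemma norm_circle_proj [simp]: "norm (circle_proj x) = 1"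
proof -
  have "norm (exp (\<i> * of_real (2 * pi * x))) = 1"
    by (rule norm_exp_i_times)
  then show ?thesis
    by (simp add: circle_proj_def mult_ac)
qed

lemma continuous_on_circle_proj: "continuous_on S circle_proj"
  unfolding circle_proj_def by (intro continuous_intros)

lemma circle_proj_add_int [simp]: "circle_proj (x + of_int k) = circle_proj x"
  by (simp add: circle_proj_eq_iff)

lemma circle_proj_surj:
  assumes "z \<in> unit_circle"
  obtains x where "a \<le> x" "x \<le> a + 1" "circle_proj x = z"
proof -
  obtain t where t: "z = exp (\<i> * of_real t)"
    using assms complex_norm_eq_1_exp[of z] by (metis mem_sphere_0)
  have z: "z = circle_proj (t / (2 * pi))"
    by (simp add: t circle_proj_def mult_ac)
  define x where "x = t / (2 * pi) + of_int (- \<lfloor>t / (2 * pi) - a\<rfloor>)"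
  have "circle_proj x = z"
    unfolding x_def circle_proj_add_int z ..
  moreover have "a \<le> x" "x \<le> a + 1"
    unfolding x_def of_int_minus by linarith+
  ultimately show ?thesis
    using that by blast
qed

section \<open>Translation numbers of increasing degree one maps\<close>

locale degree_one_map =
  fixes G :: "real \<Rightarrow> real"
  assumes cont: "continuous_on UNIV G"
    and mono: "strict_mono G"
    and add_1: "G (x + 1) = G x + 1"
begin

lemma add_int: "G (x + of_int k) = G x + of_int k"
proof -
  have nat: "G (x + real n) = G x + real n" for x n
  proof (induction n)
    case (Suc n)
    have "G (x + real (Suc n)) = G ((x + real n) + 1)"
      by (simp add: algebra_simps)
    then show ?case
      using Suc by (simp only: add_1)
  qed simp
  show ?thesis
  proof (cases "k \<ge> 0")
    case True
    then show ?thesis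
      using nat[of x "nat k"] by simp
  next
    case False
    then show ?thesis
      using nat[of "x + of_int k" "nat (- k)"] by simp
  qed
qed

lemma degree_one_funpow: "degree_one_map (G ^^ n)"
proof
  show "continuous_on UNIV (G ^^ n)"
  proof (induction n)
    case 0
    then show ?case
      by (simp add: continuous_on_id)
  next
    case (Suc n)
    then show ?case
      using continuous_on_compose[OF Suc continuous_on_subset[OF cont]] by simp
  qed
  show "strict_mono (G ^^ n)"
    by (induction n) (auto simp: strict_mono_def strict_monoD[OF mono])
  show "(G ^^ n) (x + 1) = (G ^^ n) x + 1" for x
    by (induction n) (simp_all add: add_1)
qed

lemma surj: "surj G"
proof (rule surjI)
  fix y
  \<comment> \<open>Since \<open>G k = G 0 + k\<close>, this choice puts \<open>y\<close> between
    the values of \<open>G\<close> at \<open>k\<close> and \<open>k + 1\<close>.\<close>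
  define k where "k = \<lfloor>y - G 0\<rfloor>"
  have "G (of_int k) \<le> y" "y \<le> G (of_int k + 1)"
    using add_int[of 0 k] unfolding k_def add_1 by simp_all linarith+
  then have "\<exists>x. of_int k \<le> x \<and> x \<le> of_int k + 1 \<and> G x = y"
    by (intro IVT') (auto intro: continuous_on_subset[OF cont])
  then show "G (SOME x. G x = y) = y"
    by (metis (mono_tags, lifting) someI_ex)
qed

text \<open>The displacement \<open>G x - x\<close> has period 1, so \<open>x\<close> may be
  replaced by \<open>frac x\<close>; there both \<open>G\<close> and the identity vary by at most 1
  from their values at 0, in the same direction.\<close>

lemma displacement_bound: "\<bar>G x - x - G 0\<bar> \<le> 1"
proof -
  have "G x = G (frac x) + of_int \<lfloor>x\<rfloor>"
    using add_int[of "frac x" "\<lfloor>x\<rfloor>"] by (simp add: frac_def)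
  moreover have "G 0 \<le> G (frac x)" "G (frac x) \<le> G (0 + 1)"
    using mono by (auto simp: strict_mono_less_eq frac_lt_1 less_imp_le)
  moreover have "0 \<le> frac x" "frac x < 1" "x = frac x + of_int \<lfloor>x\<rfloor>"
    by (simp_all add: frac_lt_1) (simp add: frac_def)
  ultimately show ?thesis
    unfolding add_1 by linarith
qed

lemma funpow_displacement_bound: "\<bar>(G ^^ n) x - x - (G ^^ n) 0\<bar> \<le> 1"
  by (rule degree_one_map.displacement_bound[OF degree_one_funpow])

text \<open>A block of \<open>n\<close> steps moves every point by \<open>(G ^^ n) 0\<close> up to
  an error of 1, and the errors of \<open>m\<close> blocks add up.\<close>

lemma funpow_mult_bound: "\<bar>(G ^^ (m * n)) 0 - real m * (G ^^ n) 0\<bar> \<le> real m"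
proof (induction m)
  case (Suc m)
  have "(G ^^ (Suc m * n)) 0 = (G ^^ n) ((G ^^ (m * n)) 0)"
    by (simp add: funpow_add)
  then show ?case
    using Suc funpow_displacement_bound[of n "(G ^^ (m * n)) 0"] by (simp add: algebra_simps)
qed simp

lemma translation_number_LIMSEQ: "(\<lambda>n. (G ^^ n) 0 / real n) \<longlonglongrightarrow> translation_number G"
proof -
  define a where "a n = (G ^^ n) 0" for n
  have one: "\<bar>a (m * n) / (m * n) - a n / n\<bar> \<le> 1 / n" if "m > 0" "n > 0" for m n
  proof -
    have "a (m * n) / (m * n) - a n / n = (a (m * n) - m * a n) / (m * n)"
      using that by (simp add: field_simps)
    then have "\<bar>a (m * n) / (m * n) - a n / n\<bar> = \<bar>a (m * n) - m * a n\<bar> / (m * n)"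
      by (simp add: abs_divide)
    also have "\<dots> \<le> m / (m * n)"
      by (intro divide_right_mono) (auto simp: a_def funpow_mult_bound)
    finally show ?thesis
      using that by simp
  qed
  \<comment> \<open>Both quotients are compared with the one at the common time
    \<open>m * n\<close>.\<close>
  have two: "\<bar>a m / m - a n / n\<bar> \<le> 1 / m + 1 / n" if "m > 0" "n > 0" for m n
    using one[OF that] one[OF that(2) that(1)] by (simp add: mult.commute)
  have "Cauchy (\<lambda>n. a n / n)"
  proof (rule metric_CauchyI)
    fix e :: real assume "e > 0"
    then obtain M where M: "inverse (real (Suc M)) < e / 2"
      using reals_Archimedean[of "e / 2"] by auto
    show "\<exists>M. \<forall>m\<ge>M. \<forall>n\<ge>M. dist (a m / m) (a n / n) < e"
    proof (intro exI allI impI)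
      fix m n assume mn: "m \<ge> Suc M" "n \<ge> Suc M"
      have "1 / m \<le> inverse (real (Suc M))" "1 / n \<le> inverse (real (Suc M))"
        using mn by (simp_all add: field_simps)
      then show "dist (a m / m) (a n / n) < e"
        using two[of m n] mn M by (simp add: dist_real_def)
    qed
  qed
  then show ?thesis
    unfolding a_def translation_number_def by (simp add: Cauchy_convergent convergent_LIMSEQ_iff[symmetric])
qed

text \<open>A subsequence of the defining limit, through which facts about \<open>G ^^ q\<close>
  reach the translation number. \<open>Suc n\<close> keeps the denominators nonzero.\<close>

lemma translation_number_LIMSEQ_mult:
  assumes "q > 0"
  shows "(\<lambda>n. (G ^^ (q * Suc n)) 0 / real (Suc n)) \<longlonglongrightarrow> real q * translation_number G"
proof -
  have "strict_mono (\<lambda>n. q * Suc n)"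
    using assms by (auto simp: strict_mono_def)
  then have "(\<lambda>n. (G ^^ (q * Suc n)) 0 / real (q * Suc n)) \<longlonglongrightarrow> translation_number G"
    using LIMSEQ_subseq_LIMSEQ[OF translation_number_LIMSEQ] by (simp only: o_def)
  then have "(\<lambda>n. real q * ((G ^^ (q * Suc n)) 0 / real (q * Suc n))) \<longlonglongrightarrow> real q * translation_number G"
    by (rule tendsto_mult_left)
  moreover have "real q * ((G ^^ (q * Suc n)) 0 / real (q * Suc n)) = (G ^^ (q * Suc n)) 0 / real (Suc n)" for n
    unfolding of_nat_mult using assms by (simp del: of_nat_Suc mult_Suc_right)
  ultimately show ?thesis
    by (simp only:)
qed

text \<open>The point \<open>x\<close> advances by exactly \<open>p\<close> every \<open>q\<close>
  steps, and the total displacement of 0 never differs from that of \<open>x\<close> by more than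
  1.\<close>

lemma translation_number_eq_of_periodic:
  assumes "q > 0" "(G ^^ q) x = x + of_int p"
  shows "real q * translation_number G = of_int p"
proof -
  have iter: "(G ^^ (q * n)) x = x + real n * of_int p" for n
  proof (induction n)
    case (Suc n)
    have "(G ^^ (q * Suc n)) x = (G ^^ q) (x + of_int (int n * p))"
      using Suc by (simp add: funpow_add)
    also have "\<dots> = (G ^^ q) x + of_int (int n * p)"
      by (rule degree_one_map.add_int[OF degree_one_funpow])
    finally show ?case
      using assms by (simp add: algebra_simps)
  qed simp
  have "(\<lambda>n. (G ^^ (q * Suc n)) 0 / real (Suc n) - of_int p) \<longlonglongrightarrow> 0"
  proof (rule Lim_null_comparison)
    show "\<forall>\<^sub>F n in sequentially. norm ((G ^^ (q * Suc n)) 0 / real (Suc n) - of_int p) \<le> inverse (real (Suc n))"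
    proof (intro always_eventually allI)
      fix n
      have "\<bar>(G ^^ (q * Suc n)) 0 - real (Suc n) * of_int p\<bar> \<le> 1"
        using funpow_displacement_bound[of "q * Suc n" x] iter[of "Suc n"] by linarith
      then have "\<bar>(G ^^ (q * Suc n)) 0 - real (Suc n) * of_int p\<bar> / real (Suc n) \<le> 1 / real (Suc n)"
        by (intro divide_right_mono) auto
      moreover have "(G ^^ (q * Suc n)) 0 / real (Suc n) - of_int p
          = ((G ^^ (q * Suc n)) 0 - real (Suc n) * of_int p) / real (Suc n)"
        by (simp add: field_simps)
      ultimately show "norm ((G ^^ (q * Suc n)) 0 / real (Suc n) - of_int p) \<le> inverse (real (Suc n))"
        by (simp only: real_norm_def abs_divide) (simp add: inverse_eq_divide)
    qed
  qed (rule LIMSEQ_inverse_real_of_nat)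
  then have "(\<lambda>n. (G ^^ (q * Suc n)) 0 / real (Suc n)) \<longlonglongrightarrow> of_int p"
    by (subst (asm) LIM_zero_iff)
  then show ?thesis
    using translation_number_LIMSEQ_mult[OF assms(1)] LIMSEQ_unique by blast
qed

text \<open>The displacement of \<open>G ^^ q\<close> is continuous and periodic, so it attains a
  minimum \<open>d\<close>. Every \<open>q\<close> steps gain at least \<open>d > p\<close>;
  attaining the minimum keeps the inequality strict in the limit.\<close>

lemma translation_number_gt:
  assumes "q > 0" "\<And>x. (G ^^ q) x > x + of_int p"
  shows "real q * translation_number G > of_int p"
proof -
  interpret Gq: degree_one_map "G ^^ q"
    by (rule degree_one_funpow)
  have cont01: "continuous_on {0..1} (\<lambda>x. (G ^^ q) x - x)"
    by (intro continuous_intros continuous_on_subset[OF Gq.cont]) auto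
  obtain x0 where x0: "\<And>x. x \<in> {0..1} \<Longrightarrow> (G ^^ q) x0 - x0 \<le> (G ^^ q) x - x"
    using continuous_attains_inf[OF compact_Icc _ cont01] by (fastforce simp del: atLeastAtMost_iff)
  define d where "d = (G ^^ q) x0 - x0"
  have d: "(G ^^ q) x \<ge> x + d" for x
    using x0[of "frac x"] Gq.add_int[of "frac x" "\<lfloor>x\<rfloor>"] by (simp add: d_def frac_def frac_lt_1 less_imp_le) linarith
  have "(G ^^ (q * n)) 0 \<ge> real n * d" for n
  proof (induction n)
    case (Suc n)
    have "(G ^^ (q * Suc n)) 0 = (G ^^ q) ((G ^^ (q * n)) 0)"
      by (simp add: funpow_add)
    then show ?case
      using Suc d[of "(G ^^ (q * n)) 0"] by (simp add: algebra_simps)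
  qed simp
  then have "d \<le> (G ^^ (q * Suc n)) 0 / real (Suc n)" for n
    by (simp add: pos_le_divide_eq mult.commute[of d] del: of_nat_Suc mult_Suc_right)
  then have "d \<le> real q * translation_number G"
    using translation_number_LIMSEQ_mult[OF assms(1)] LIMSEQ_le_const by blast
  then show ?thesis
    using assms(2)[of x0] by (simp add: d_def)
qed

lemma translation_number_lt:
  assumes "q > 0" "\<And>x. (G ^^ q) x < x + of_int p"
  shows "real q * translation_number G < of_int p"
proof -
  interpret Gq: degree_one_map "G ^^ q"
    by (rule degree_one_funpow)
  have cont01: "continuous_on {0..1} (\<lambda>x. (G ^^ q) x - x)"
    by (intro continuous_intros continuous_on_subset[OF Gq.cont]) auto
  obtain x0 where x0: "\<And>x. x \<in> {0..1} \<Longrightarrow> (G ^^ q) x0 - x0 \<ge> (G ^^ q) x - x"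
    using continuous_attains_sup[OF compact_Icc _ cont01] by (fastforce simp del: atLeastAtMost_iff)
  define d where "d = (G ^^ q) x0 - x0"
  have d: "(G ^^ q) x \<le> x + d" for x
    using x0[of "frac x"] Gq.add_int[of "frac x" "\<lfloor>x\<rfloor>"] by (simp add: d_def frac_def frac_lt_1 less_imp_le) linarith
  have "(G ^^ (q * n)) 0 \<le> real n * d" for n
  proof (induction n)
    case (Suc n)
    have "(G ^^ (q * Suc n)) 0 = (G ^^ q) ((G ^^ (q * n)) 0)"
      by (simp add: funpow_add)
    then show ?case
      using Suc d[of "(G ^^ (q * n)) 0"] by (simp add: algebra_simps)
  qed simp
  then have "(G ^^ (q * Suc n)) 0 / real (Suc n) \<le> d" for n
    by (simp add: pos_divide_le_eq mult.commute[of d] del: of_nat_Suc mult_Suc_right)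
  then have "real q * translation_number G \<le> d"
    using translation_number_LIMSEQ_mult[OF assms(1)] LIMSEQ_le_const2 by blast
  then show ?thesis
    using assms(2)[of x0] by (simp add: d_def)
qed

text \<open>If the displacement of \<open>G ^^ q\<close> were everywhere above or everywhere below
  \<open>p\<close>, then \<open>q\<close> times the translation number could not equal
  \<open>p\<close>. So it takes values on both sides of \<open>p\<close> and, by connectedness,
  \<open>p\<close> itself.\<close>

lemma translation_number_rational_iff:
  "translation_number G \<in> \<rat> \<longleftrightarrow> (\<exists>q>0. \<exists>p x. (G ^^ q) x = x + of_int p)"
proof
  assume "translation_number G \<in> \<rat>"
  then obtain p q where pq: "translation_number G = of_int p / real q" "q > 0"
    unfolding Rats_eq_int_div_nat by auto
  interpret Gq: degree_one_map "G ^^ q"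
    by (rule degree_one_funpow)
  have tn: "real q * translation_number G = of_int p"
    using pq by simp
  have "\<exists>x. (G ^^ q) x \<le> x + of_int p"
    using translation_number_gt[OF pq(2), of p] tn by (force simp: not_le[symmetric])
  moreover have "\<exists>y. (G ^^ q) y \<ge> y + of_int p"
    using translation_number_lt[OF pq(2), of p] tn by (force simp: not_le[symmetric])
  ultimately obtain x y where "(G ^^ q) x \<le> x + of_int p" "(G ^^ q) y \<ge> y + of_int p"
    by blast
  moreover have "connected (range (\<lambda>x. (G ^^ q) x - x))"
    by (intro connected_continuous_image continuous_intros Gq.cont connected_UNIV)
  ultimately have "of_int p \<in> range (\<lambda>x. (G ^^ q) x - x)"
    using connectedD_interval[of "range (\<lambda>x. (G ^^ q) x - x)" "(G ^^ q) x - x" "(G ^^ q) y - y" "of_int p"]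
    by (simp add: algebra_simps)
  then obtain z where "(G ^^ q) z = z + of_int p"
    by (auto simp: algebra_simps)
  then show "\<exists>q>0. \<exists>p x. (G ^^ q) x = x + of_int p"
    using pq(2) by blast
next
  assume "\<exists>q>0. \<exists>p x. (G ^^ q) x = x + of_int p"
  then obtain q p where "q > 0" "real q * translation_number G = of_int p"
    using translation_number_eq_of_periodic by blast
  then have "translation_number G = of_int p / of_nat q"
    by (simp add: field_simps)
  then show "translation_number G \<in> \<rat>"
    by simp
qed

end

section \<open>Lifts of circle homeomorphisms\<close>

lemma degree_one_map_lift:
  assumes "inj_on g unit_circle" "is_lift G g"
  shows "degree_one_map G"
proof
  show cont: "continuous_on UNIV G" and mono: "strict_mono G"
    using assms(2) by (auto simp: is_lift_def)
  have proj: "circle_proj (G x) = g (circle_proj x)" for x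
    using assms(2) by (auto simp: is_lift_def)
  fix x
  have "circle_proj (G (x + 1)) = circle_proj (G x)"
    using circle_proj_add_int[of x 1] by (simp add: proj)
  then obtain k where k: "G (x + 1) - G x = of_int k"
    unfolding circle_proj_eq_iff by (auto elim: Ints_cases)
  have "G x < G (x + 1)"
    using mono by (simp add: strict_mono_less)
  with k have "k \<ge> 1"
    by linarith
  then have "G x \<le> G x + 1" "G x + 1 \<le> G (x + 1)"
    using k by linarith+
  \<comment> \<open>The graph first gains 1 at \<open>y\<close>. By injectivity of \<open>g\<close>
    on the circle, \<open>y\<close> and \<open>x\<close> project to the same point, which leaves
    only \<open>y = x + 1\<close>.\<close>
  then obtain y where y: "x \<le> y" "y \<le> x + 1" "G y = G x + 1"
    using IVT'[of G x "G x + 1" "x + 1"] continuous_on_subset[OF cont] by auto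
  then have "circle_proj (G y) = circle_proj (G x)"
    by (simp add: circle_proj_eq_iff)
  then have "circle_proj y = circle_proj x"
    using assms(1) by (simp only: proj inj_on_eq_iff mem_sphere_0 norm_circle_proj)
  then obtain j where j: "y - x = of_int j"
    unfolding circle_proj_eq_iff by (auto elim: Ints_cases)
  have "y \<noteq> x"
    using y by auto
  with y j have "j = 1"
    by auto
  with j y show "G (x + 1) = G x + 1"
    by (metis add.commute diff_add_cancel of_int_1)
qed

lemma lift_funpow:
  assumes "is_lift G g"
  shows "circle_proj ((G ^^ n) x) = (g ^^ n) (circle_proj x)"
  using assms by (induction n) (auto simp: is_lift_def)

lemma frac_in_Rats_iff: "frac x \<in> \<rat> \<longleftrightarrow> x \<in> \<rat>" for x :: real
proof -
  have "frac x + of_int \<lfloor>x\<rfloor> = x"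
    by (simp add: frac_def)
  then show ?thesis
    by (metis Rats_add Rats_diff Rats_of_int frac_def)
qed

lemma rotation_number_rational_iff:
  assumes "orientation_preserving_homeo g"
  obtains G where "is_lift G g" "degree_one_map G"
    "rotation_number g \<in> \<rat> \<longleftrightarrow> (\<exists>q>0. \<exists>p x. (G ^^ q) x = x + of_int p)"
proof -
  \<comment> \<open>This is the very lift that \<open>rotation_number\<close> selects, so its
    definition can be unfolded with \<open>G\<close>.\<close>
  define G where "G = (SOME G. is_lift G g)"
  have G: "is_lift G g"
    unfolding G_def using assms by (metis orientation_preserving_homeo_def someI_ex)
  obtain h where "homeomorphism unit_circle unit_circle g h"
    using assms by (auto simp: orientation_preserving_homeo_def)
  then have "inj_on g unit_circle"
    by (intro inj_on_inverseI[of _ h]) (auto simp: homeomorphism_def)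
  then interpret degree_one_map G
    using G by (rule degree_one_map_lift)
  show ?thesis
    using that[OF G degree_one_map_axioms] translation_number_rational_iff
    by (simp add: rotation_number_def frac_in_Rats_iff flip: G_def)
qed


section \<open>Periodic configurations\<close>

text \<open>Pigeonhole: an orbit in a finite set revisits a point, and that point is
  periodic.\<close>

lemma finite_self_map_periodic:
  assumes "finite S" "S \<noteq> {}" "f ` S \<subseteq> S"
  shows "\<exists>p>0. \<exists>q\<in>S. (f ^^ p) q = q"
proof -
  obtain q0 where "q0 \<in> S"
    using assms(2) by auto
  have S: "(f ^^ n) q0 \<in> S" for n
    by (induction n) (use \<open>q0 \<in> S\<close> assms(3) in auto)
  then have "finite (range (\<lambda>n. (f ^^ n) q0))"
    using assms(1) by (auto intro: finite_subset)
  then have "\<not> inj (\<lambda>n. (f ^^ n) q0)"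
    using finite_imageD infinite_UNIV_nat by blast
  then obtain m n where mn: "m < n" "(f ^^ m) q0 = (f ^^ n) q0"
    unfolding inj_def by (metis linorder_neqE_nat)
  have "(f ^^ (n - m)) ((f ^^ m) q0) = (f ^^ (n - m + m)) q0"
    by (simp add: funpow_add)
  then show ?thesis
    using S[of m] mn by (intro exI[of _ "n - m"] conjI bexI[of _ "(f ^^ m) q0"]) auto
qed

section \<open>The effect of a sequence of actions on one tape\<close>

definition prepend :: "'a list \<Rightarrow> (nat \<Rightarrow> 'a) \<Rightarrow> nat \<Rightarrow> 'a" where
  "prepend w u i = (if i < length w then w ! i else u (i - length w))"

lemma act_Push_prepend: "act (Push a) (prepend w u) = prepend (a # w) u"
  by (rule ext) (auto simp: prepend_def split: nat.split)

text \<open>Without \<open>Drop\<close> nothing is ever removed, so the actions only put a fixed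
  word in front of the tape: the pushed letters, the last one first.\<close>

lemma fold_act_output:
  assumes "Drop \<notin> set as"
  obtains w where "\<And>u. fold act as u = prepend w u" "set w \<subseteq> {a. Push a \<in> set as}"
proof -
  have "\<exists>w. (\<forall>u. fold act as u = prepend w u) \<and> set w \<subseteq> {a. Push a \<in> set as}"
    using assms
  proof (induction as rule: rev_induct)
    case Nil
    then show ?case
      by (intro exI[of _ "[]"]) (simp add: prepend_def fun_eq_iff)
  next
    case (snoc s as)
    then obtain w where w: "\<forall>u. fold act as u = prepend w u" "set w \<subseteq> {a. Push a \<in> set as}"
      by auto
    show ?case
    proof (cases s)
      case Stay
      then show ?thesis
        using w by (intro exI[of _ w]) auto
    next
      case (Push a)
      then show ?thesis
        using w by (intro exI[of _ "a # w"]) (auto simp: act_Push_prepend simp del: act.simps)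
    qed (use snoc.prems in auto)
  qed
  then show ?thesis
    using that by blast
qed

text \<open>The periodic content is the infinite repetition of the word pushed during one period.\<close>

lemma fold_act_output_fixed_point:
  assumes "Drop \<notin> set as" "fold act as (\<lambda>_. a) 0 = a"
  shows "\<exists>x. x 0 = a \<and> fold act as x = x \<and> range x \<subseteq> insert a {b. Push b \<in> set as}"
proof -
  obtain w where w: "\<And>u. fold act as u = prepend w u" "set w \<subseteq> {a. Push a \<in> set as}"
    using fold_act_output[OF assms(1)] by blast
  show ?thesis
  proof (cases "w = []")
    case True
    then show ?thesis
      by (intro exI[of _ "\<lambda>_. a"]) (auto simp: w prepend_def fun_eq_iff)
  next
    case False
    define x where "x i = w ! (i mod length w)" for i
    \<comment> \<open>For nonempty \<open>w\<close> the second assumption says that \<open>w\<close>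
      begins with \<open>a\<close>.\<close>
    have "x 0 = a"
      using assms(2) False by (simp add: w x_def prepend_def)
    moreover have "prepend w x = x"
      by (auto simp: fun_eq_iff prepend_def x_def le_mod_geq)
    moreover have "x i \<in> set w" for i
      using False by (simp add: x_def)
    ultimately show ?thesis
      using w by (intro exI[of _ x]) auto
  qed
qed

lemma finite_automaton_periodic:
  assumes "finite_automaton T A F" "configs T A \<noteq> {}"
  obtains v p where "v \<in> configs T A" "p > 0" "(automaton_map T F ^^ p) v = v"
proof -
  have fin: "finite T" "\<And>t. t \<in> T \<Longrightarrow> finite (A t)"
    and io: "\<And>t. t \<in> T \<Longrightarrow> input_tape T A F t \<or> output_tape T A F t"
    and F: "\<And>t q. t \<in> T \<Longrightarrow> q \<in> states T A \<Longrightarrow> F t q \<in> Push ` A t \<union> {Stay, Drop}"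
    using assms(1) by (auto simp: finite_automaton_def automaton_def)
  \<comment> \<open>With constant input tapes, the next state depends on the current state alone.\<close>
  define \<delta> where "\<delta> q = (\<lambda>t\<in>T. case F t q of Push a \<Rightarrow> a | _ \<Rightarrow> q t)" for q
  have \<delta>: "\<delta> q \<in> states T A" if "q \<in> states T A" for q
  proof -
    have "(case F t q of Push a \<Rightarrow> a | _ \<Rightarrow> q t) \<in> A t" if "t \<in> T" for t
    proof -
      have "q t \<in> A t"
        using \<open>q \<in> states T A\<close> that by (simp add: states_def PiE_mem)
      moreover have "F t q \<in> Push ` A t \<union> {Stay, Drop}"
        using F[OF that \<open>q \<in> states T A\<close>] .
      ultimately show ?thesis
        by (cases "F t q") auto
    qed
    then show ?thesis
      by (auto simp: \<delta>_def states_def)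
  qed
  obtain u where "u \<in> configs T A"
    using assms(2) by auto
  then have "head T u \<in> states T A"
    by (auto simp: head_def states_def configs_def PiE_iff)
  then have "states T A \<noteq> {}" "\<delta> ` states T A \<subseteq> states T A"
    using \<delta> by auto
  moreover have "finite (states T A)"
    unfolding states_def by (intro finite_PiE fin)
  ultimately have "\<exists>p>0. \<exists>q\<in>states T A. (\<delta> ^^ p) q = q"
    by (intro finite_self_map_periodic)
  then obtain q p where qp: "q \<in> states T A" "p > 0" "(\<delta> ^^ p) q = q"
    by auto
  have \<delta>_at: "\<delta> q t = (case F t q of Push a \<Rightarrow> a | _ \<Rightarrow> q t)" if "t \<in> T" for q t
    using that by (simp add: \<delta>_def)
  have \<delta>n: "(\<delta> ^^ n) q \<in> states T A" for n
    by (induction n) (use qp(1) \<delta> in auto)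
  \<comment> \<open>The actions that tape \<open>t\<close> undergoes in the first \<open>n\<close>
    steps if the state follows its \<open>\<delta>\<close>-orbit. With these lists fixed in advance,
    the tapes can be treated one at a time.\<close>
  define as where "as n t = map (\<lambda>k. F t ((\<delta> ^^ k) q)) [0..<n]" for n t
  have as_Suc: "fold act (as (Suc n) t) u = act (F t ((\<delta> ^^ n) q)) (fold act (as n t) u)" for n t u
    by (simp add: as_def)
  \<comment> \<open>\<open>Stay\<close> and \<open>Drop\<close> fix a constant sequence, and
    \<open>\<delta>\<close> leaves the letter of an input tape alone.\<close>
  have in_const: "fold act (as n t) (\<lambda>_. q t) = (\<lambda>_. q t) \<and> (\<delta> ^^ n) q t = q t"
    if "t \<in> T" "input_tape T A F t" for n t
  proof (induction n)
    case (Suc n)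
    have "F t ((\<delta> ^^ n) q) \<in> {Stay, Drop}"
      using that(2) \<delta>n unfolding input_tape_def by blast
    then show ?case
      using Suc that(1) by (auto simp: as_Suc \<delta>_at)
  qed (simp add: as_def)
  \<comment> \<open>Only the head of \<open>u\<close> matters: each later head is either unchanged
    or the letter just pushed.\<close>
  have out_head: "fold act (as n t) u 0 = (\<delta> ^^ n) q t"
    if "t \<in> T" "output_tape T A F t" "u 0 = q t" for n t u
  proof (induction n)
    case (Suc n)
    have "F t ((\<delta> ^^ n) q) \<in> Push ` A t \<union> {Stay}"
      using that(2) \<delta>n unfolding output_tape_def by blast
    then show ?case
      using Suc that(1) by (auto simp: as_Suc \<delta>_at)
  qed (simp add: as_def that)
  \<comment> \<open>A content is suitable if it returns after \<open>p\<close> steps and its head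
    always shows the letter that the \<open>\<delta>\<close>-orbit predicts.\<close>
  define good where "good t x \<longleftrightarrow> fold act (as p t) x = x \<and> range x \<subseteq> A t
      \<and> (\<forall>n. fold act (as n t) x 0 = (\<delta> ^^ n) q t)" for t x
  have good: "\<exists>x. good t x" if "t \<in> T" for t
  proof -
    have qt: "q t \<in> A t"
      using qp(1) that by (auto simp: states_def)
    show ?thesis
    proof (cases "input_tape T A F t")
      case True
      then show ?thesis
        using in_const[OF that True] qt by (intro exI[of _ "\<lambda>_. q t"]) (auto simp: good_def)
    next
      case False
      then have out: "output_tape T A F t"
        using io that by auto
      have step: "F t ((\<delta> ^^ k) q) \<in> Push ` A t \<union> {Stay}" for k
        using out \<delta>n unfolding output_tape_def by blast
      have "s \<in> Push ` A t \<union> {Stay}" if "s \<in> set (as p t)" for s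
        using that step by (auto simp: as_def)
      then have "Drop \<notin> set (as p t)" and letters: "insert (q t) {b. Push b \<in> set (as p t)} \<subseteq> A t"
        using qt by blast+
      moreover have "fold act (as p t) (\<lambda>_. q t) 0 = q t"
        using out_head[OF that out, of "\<lambda>_. q t" p] qp(3) by simp
      ultimately have "\<exists>x. x 0 = q t \<and> fold act (as p t) x = x
          \<and> range x \<subseteq> insert (q t) {b. Push b \<in> set (as p t)}"
        by (intro fold_act_output_fixed_point)
      then obtain x where x: "x 0 = q t" "fold act (as p t) x = x"
          "range x \<subseteq> insert (q t) {b. Push b \<in> set (as p t)}"
        by (elim exE conjE)
      then have "range x \<subseteq> A t"
        by (intro order_trans[OF _ letters])
      then show ?thesis
        unfolding good_def using x out_head[OF that out, of x, OF x(1)] by (intro exI[of _ x] conjI allI)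
    qed
  qed
  obtain x where good_x: "\<And>t. t \<in> T \<Longrightarrow> good t (x t)"
    using good by metis
  have x: "fold act (as p t) (x t) = x t" "x t i \<in> A t" "fold act (as n t) (x t) 0 = (\<delta> ^^ n) q t" if "t \<in> T" for t i n
    using good_x[OF that] unfolding good_def by blast+
  define v where "v = (\<lambda>t\<in>T. x t)"
  \<comment> \<open>The heads keep agreeing with the predicted states, so the automaton really
    performs the prescribed action lists.\<close>
  have iter: "(automaton_map T F ^^ n) v = (\<lambda>t\<in>T. fold act (as n t) (x t))" for n
  proof (induction n)
    case 0
    then show ?case
      by (simp add: v_def as_def)
  next
    case (Suc n)
    have head: "head T (\<lambda>t\<in>T. fold act (as n t) (x t)) = (\<delta> ^^ n) q"
    proof (rule extensionalityI[of _ T])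
      show "(\<delta> ^^ n) q \<in> extensional T"
        using \<delta>n[of n] by (simp add: states_def PiE_iff)
    qed (simp_all add: head_def x(3))
    have "(automaton_map T F ^^ Suc n) v = automaton_map T F (\<lambda>t\<in>T. fold act (as n t) (x t))"
      by (simp only: funpow.simps o_apply Suc)
    also have "\<dots> = (\<lambda>t\<in>T. fold act (as (Suc n) t) (x t))"
      unfolding automaton_map_def head by (intro restrict_ext) (simp add: as_Suc)
    finally show ?case .
  qed
  show ?thesis
  proof (rule that)
    show "v \<in> configs T A"
      using x(2) by (simp add: v_def configs_def)
    show "(automaton_map T F ^^ p) v = v"
      unfolding iter by (simp add: v_def x(1) cong: restrict_cong)
  qed (rule qp(2))
qed


section \<open>Topology of the configuration space\<close>

text \<open>The cylinders of the configuration space; continuity is checked on them rather than with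
  the metric.\<close>

definition agree :: "'t set \<Rightarrow> nat \<Rightarrow> ('t \<Rightarrow> nat \<Rightarrow> 'a) \<Rightarrow> ('t \<Rightarrow> nat \<Rightarrow> 'a) \<Rightarrow> bool" where
  "agree T n u v \<longleftrightarrow> (\<forall>t\<in>T. \<forall>i<n. u t i = v t i)"

lemma agree_mono: "agree T n u v \<Longrightarrow> m \<le> n \<Longrightarrow> agree T m u v"
  by (auto simp: agree_def)

lemma agree_if_config_dist_less:
  assumes "finite T" "config_dist T u v < (1/2) ^ n"
  shows "agree T n u v"
  unfolding agree_def
proof (intro ballI)
  fix t assume "t \<in> T"
  then have "seq_dist (u t) (v t) \<le> config_dist T u v"
    unfolding config_dist_def using assms(1) by (intro member_le_sum) auto
  then have "seq_dist (u t) (v t) \<le> (1/2) ^ n"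
    using assms(2) by linarith
  then show "\<forall>i<n. u t i = v t i"
    using seq_dist_le_iff_agree[of "u t" "v t" n] by (cases "u t = v t") auto
qed

lemma config_dist_le_if_agree:
  assumes "agree T n u v"
  shows "config_dist T u v \<le> real (card T) * (1/2) ^ n"
proof -
  have "seq_dist (u t) (v t) \<le> (1/2) ^ n" if "t \<in> T" for t
    using assms that seq_dist_le_iff_agree[of "u t" "v t" n]
    by (cases "u t = v t") (auto simp: agree_def seq_dist_def)
  then show ?thesis
    unfolding config_dist_def by (rule sum_bounded_above)
qed

lemma agree_imp_config_dist_less:
  assumes "e > 0"
  obtains n where "\<And>u v. agree T n u v \<Longrightarrow> config_dist T u v < e"
proof -
  have "(\<lambda>n. real (card T) * (1/2) ^ n) \<longlonglongrightarrow> real (card T) * 0"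
    by (intro tendsto_mult_left LIMSEQ_power_zero) auto
  then have "\<forall>\<^sub>F n in sequentially. real (card T) * (1/2) ^ n < e"
    using assms order_tendstoD(2) by fastforce
  then obtain n where "real (card T) * (1/2) ^ n < e"
    by (auto simp: eventually_sequentially)
  then show ?thesis
    using that config_dist_le_if_agree by (meson order_le_less_trans)
qed

text \<open>A ball of radius \<open>(1/2) ^ n\<close> lies in the cylinder of length
  \<open>n\<close>, so it suffices to control \<open>f\<close> on cylinders.\<close>

lemma continuous_map_config_metric:
  assumes "finite T" "f ` configs T A \<subseteq> mspace Y"
    and "\<And>u e. u \<in> configs T A \<Longrightarrow> e > 0 \<Longrightarrow>
      \<exists>n. \<forall>v\<in>configs T A. agree T n u v \<longrightarrow> mdist Y (f u) (f v) < e"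
  shows "continuous_map (mtopology_of (config_metric T A)) (mtopology_of Y) f"
proof -
  interpret X: Metric_space "configs T A" "config_dist T"
    using assms(1) by (rule Metric_space_configs)
  interpret Y: Metric_space "mspace Y" "mdist Y"
    by simp
  have "continuous_map X.mtopology Y.mtopology f"
    unfolding X.metric_continuous_map[OF Y.Metric_space_axioms]
  proof (intro conjI assms(2) ballI allI impI)
    fix u and e :: real
    assume u: "u \<in> configs T A" and "e > 0"
    then obtain n where n: "\<And>v. v \<in> configs T A \<Longrightarrow> agree T n u v \<Longrightarrow> mdist Y (f u) (f v) < e"
      using assms(3) by meson
    show "\<exists>d>0. \<forall>v. v \<in> configs T A \<and> config_dist T u v < d \<longrightarrow> mdist Y (f u) (f v) < e"
      using n agree_if_config_dist_less[OF assms(1)] by (intro exI[of _ "(1/2) ^ n"]) auto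
  qed
  then show ?thesis
    using assms(1) by (simp add: mtopology_of_def mspace_config_metric mdist_config_metric)
qed

text \<open>Convergence in the product topology implies convergence in the metric, so compactness is
  inherited from Tychonoff's theorem.\<close>

lemma compact_space_config_metric:
  fixes A :: "'t \<Rightarrow> 'a set"
  assumes "finite T" "\<And>t. t \<in> T \<Longrightarrow> finite (A t)"
  shows "compact_space (mtopology_of (config_metric T A))"
proof -
  interpret X: Metric_space "configs T A" "config_dist T"
    using assms(1) by (rule Metric_space_configs)
  define P where "P = product_topology (\<lambda>t. product_topology (\<lambda>i::nat. discrete_topology (A t)) UNIV) T"
  have top: "topspace P = configs T A"
    by (auto simp: P_def configs_def PiE_def)
  have comp: "compact_space P"
    unfolding P_def using assms(2)
    by (simp add: compact_space_product_topology compact_space_discrete_topology)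
  have coord: "continuous_map P (discrete_topology (A t)) (\<lambda>u. u t i)" if "t \<in> T" for t i
  proof -
    have "continuous_map P (product_topology (\<lambda>i::nat. discrete_topology (A t)) UNIV) (\<lambda>u. u t)"
      unfolding P_def using that by (rule continuous_map_product_projection)
    moreover have "continuous_map (product_topology (\<lambda>i::nat. discrete_topology (A t)) UNIV) (discrete_topology (A t)) (\<lambda>x. x i)"
      by (rule continuous_map_product_projection) simp
    ultimately show ?thesis
      using continuous_map_compose by (fastforce simp: o_def)
  qed
  \<comment> \<open>A cylinder restricts finitely many coordinates, each with values in a discrete
    space.\<close>
  have cyl: "openin P {v \<in> topspace P. agree T n u v}" if "u \<in> configs T A" for u n
  proof -
    have one: "openin P {v \<in> topspace P. v t i \<in> {u t i}}" if "t \<in> T" for t i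
      using openin_continuous_map_preimage[OF coord[OF that, of i], of "{u t i}"] \<open>u \<in> configs T A\<close> that
      by (auto simp: configs_def PiE_iff)
    \<comment> \<open>The factor \<open>topspace P\<close> gives the empty intersection its correct
      meaning when \<open>n = 0\<close>.\<close>
    have "openin P ((\<Inter>i\<in>{..<n}. {v \<in> topspace P. v t i \<in> {u t i}}) \<inter> topspace P)" if "t \<in> T" for t
      by (intro openin_INT one that finite_lessThan)
    then have "openin P ((\<Inter>t\<in>T. (\<Inter>i\<in>{..<n}. {v \<in> topspace P. v t i \<in> {u t i}}) \<inter> topspace P) \<inter> topspace P)"
      by (intro openin_INT[OF assms(1)])
    moreover have "(\<Inter>t\<in>T. (\<Inter>i\<in>{..<n}. {v \<in> topspace P. v t i \<in> {u t i}}) \<inter> topspace P) \<inter> topspace P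
        = {v \<in> topspace P. agree T n u v}"
      by (auto simp: agree_def)
    ultimately show ?thesis
      by simp
  qed
  have "continuous_map P X.mtopology id"
    unfolding X.continuous_map_to_metric
  proof (intro ballI allI impI)
    fix u and e :: real
    assume u: "u \<in> topspace P" and "e > 0"
    then obtain n where n: "\<And>u v :: 't \<Rightarrow> nat \<Rightarrow> 'a. agree T n u v \<Longrightarrow> config_dist T u v < e"
      using agree_imp_config_dist_less by metis
    show "\<exists>U. openin P U \<and> u \<in> U \<and> (\<forall>v\<in>U. id v \<in> X.mball (id u) e)"
      using cyl[of u n] u n top by (intro exI[of _ "{v \<in> topspace P. agree T n u v}"]) (auto simp: agree_def)
  qed
  then have "compactin X.mtopology (id ` topspace P)"
    using comp by (intro image_compactin[of P]) (auto simp: compact_space_def)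
  then show ?thesis
    using assms(1) top
    by (simp add: compact_space_def mtopology_of_def mspace_config_metric mdist_config_metric)
qed

lemma automaton_map_in_configs:
  assumes "automaton T A F" "u \<in> configs T A"
  shows "automaton_map T F u \<in> configs T A"
proof -
  have "head T u \<in> states T A"
    using assms(2) by (auto simp: head_def states_def configs_def PiE_iff)
  have "act (F t (head T u)) (u t) \<in> UNIV \<rightarrow> A t" if "t \<in> T" for t
  proof -
    have "F t (head T u) \<in> Push ` A t \<union> {Stay, Drop}"
      using assms(1) that \<open>head T u \<in> states T A\<close> by (simp add: automaton_def)
    moreover have "u t i \<in> A t" for i
      using assms(2) that by (auto simp: configs_def PiE_iff)
    ultimately show ?thesis
      by (auto split: nat.split)
  qed
  then show ?thesis
    by (simp add: automaton_map_def configs_def)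
qed

text \<open>A \<open>Drop\<close> uses up one symbol, hence \<open>Suc n\<close>; the extra symbol
  also makes the heads, and so the actions, agree.\<close>

lemma agree_automaton_map:
  assumes "agree T (Suc n) u v"
  shows "agree T n (automaton_map T F u) (automaton_map T F v)"
proof -
  have "head T u = head T v"
    using assms by (auto simp: head_def agree_def)
  moreover have "act s (u t) i = act s (v t) i" if "t \<in> T" "i < n" for s t i
    using assms that by (cases s) (auto simp: agree_def split: nat.split)
  ultimately show ?thesis
    by (simp add: agree_def automaton_map_def)
qed

lemma dynamical_system_automaton:
  fixes A :: "'t \<Rightarrow> 'a set"
  assumes "automaton T A F"
  shows "dynamical_system (config_metric T A) (automaton_map T F)"
proof -
  have fin: "finite T" "\<And>t. t \<in> T \<Longrightarrow> finite (A t)"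
    using assms by (auto simp: automaton_def)
  have "continuous_map (mtopology_of (config_metric T A)) (mtopology_of (config_metric T A)) (automaton_map T F)"
  proof (rule continuous_map_config_metric[OF fin(1)])
    show "automaton_map T F ` configs T A \<subseteq> mspace (config_metric T A)"
      using automaton_map_in_configs[OF assms] fin(1) by (auto simp: mspace_config_metric)
  next
    fix u and e :: real
    assume "e > 0"
    then obtain n where n: "\<And>u v :: 't \<Rightarrow> nat \<Rightarrow> 'a. agree T n u v \<Longrightarrow> config_dist T u v < e"
      using agree_imp_config_dist_less by metis
    show "\<exists>n. \<forall>v\<in>configs T A. agree T n u v \<longrightarrow>
        mdist (config_metric T A) (automaton_map T F u) (automaton_map T F v) < e"
      unfolding mdist_config_metric[OF fin(1)]
      by (intro exI[of _ "Suc n"] ballI impI n agree_automaton_map)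
  qed
  then show ?thesis
    unfolding dynamical_system_def using compact_space_config_metric fin by blast
qed

lemma dynamical_system_circle:
  assumes "continuous_on unit_circle g" "g ` unit_circle \<subseteq> unit_circle"
  shows "dynamical_system circle_metric g"
proof -
  have "mtopology_of circle_metric = top_of_set unit_circle"
    by (simp add: circle_metric_def mtopology_of_submetric)
  then show ?thesis
    using assms by (auto simp: dynamical_system_def compact_space_subtopology compactin_euclidean_iff)
qed


section \<open>Coding a compact set of reals by binary sequences\<close>

text \<open>The cut is at the midpoint of the convex hull of \<open>S\<close>, so each half keeps
  one of the endpoints \<open>Inf S\<close> and \<open>Sup S\<close> of a compact nonempty
  \<open>S\<close>. No half is empty, and therefore every binary sequence is a valid code.\<close>

definition bisect :: "real set \<Rightarrow> nat \<Rightarrow> real set" where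
  "bisect S b = (if b = 0 then S \<inter> {..(Inf S + Sup S) / 2} else S \<inter> {(Inf S + Sup S) / 2..})"

fun code_set :: "real set \<Rightarrow> (nat \<Rightarrow> nat) \<Rightarrow> nat \<Rightarrow> real set" where
  "code_set K u 0 = K"
| "code_set K u (Suc n) = bisect (code_set K u n) (u n)"

text \<open>For compact nonempty \<open>K\<close> the nested code sets shrink to exactly one point,
  which \<open>SOME\<close> returns.\<close>

definition decode :: "real set \<Rightarrow> (nat \<Rightarrow> nat) \<Rightarrow> real" where
  "decode K u = (SOME x. x \<in> (\<Inter>n. code_set K u n))"

lemma bisect:
  fixes S :: "real set"
  assumes "compact S" "S \<noteq> {}"
  shows "compact (bisect S b)" "bisect S b \<noteq> {}" "bisect S b \<subseteq> S"
    and "Sup (bisect S b) - Inf (bisect S b) \<le> (Sup S - Inf S) / 2"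
proof -
  have bdd: "bdd_above S" "bdd_below S" and closed: "closed S"
    using assms(1) by (auto simp: compact_imp_bounded bounded_imp_bdd_above bounded_imp_bdd_below compact_imp_closed)
  have ends: "Inf S \<in> S" "Sup S \<in> S"
    using closed_contains_Inf closed_contains_Sup assms(2) bdd closed by auto
  then have "Inf S \<le> Sup S"
    using bdd by (simp add: cInf_lower)
  define m where "m = (Inf S + Sup S) / 2"
  have m: "Inf S \<le> m" "m \<le> Sup S"
    using \<open>Inf S \<le> Sup S\<close> by (auto simp: m_def)
  show "compact (bisect S b)" "bisect S b \<subseteq> S"
    using assms(1) by (auto simp: bisect_def intro: compact_Int_closed)
  show ne: "bisect S b \<noteq> {}"
    using ends m by (auto simp: bisect_def m_def)
  show "Sup (bisect S b) - Inf (bisect S b) \<le> (Sup S - Inf S) / 2"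
  proof (cases "b = 0")
    case True
    have "Sup (bisect S b) \<le> m"
      using ne by (rule cSup_least) (use True in \<open>simp add: bisect_def m_def\<close>)
    moreover have "Inf S \<le> Inf (bisect S b)"
      using ne bdd(2) by (rule cInf_superset_mono) (simp add: bisect_def)
    ultimately show ?thesis
      by (simp add: m_def field_simps)
  next
    case False
    have "m \<le> Inf (bisect S b)"
      using ne by (rule cInf_greatest) (use False in \<open>simp add: bisect_def m_def\<close>)
    moreover have "Sup (bisect S b) \<le> Sup S"
      using ne bdd(1) by (rule cSup_subset_mono) (simp add: bisect_def)
    ultimately show ?thesis
      by (simp add: m_def field_simps)
  qed
qed

context
  fixes K :: "real set"
  assumes K: "compact K" "K \<noteq> {}"
begin

lemma code_set: "compact (code_set K u n)" "code_set K u n \<noteq> {}"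
  by (induction n) (auto simp: K bisect)

lemma code_set_Suc_subset: "code_set K u (Suc n) \<subseteq> code_set K u n"
  using bisect(3) code_set by simp

lemma code_set_width: "Sup (code_set K u n) - Inf (code_set K u n) \<le> (Sup K - Inf K) * (1/2) ^ n"
proof (induction n)
  case (Suc n)
  then show ?case
    using bisect(4)[OF code_set, of u n "u n"] by simp
qed simp

lemma code_set_dist:
  assumes "x \<in> code_set K u n" "y \<in> code_set K u n"
  shows "\<bar>x - y\<bar> \<le> (Sup K - Inf K) * (1/2) ^ n"
proof -
  have "bdd_above (code_set K u n)" "bdd_below (code_set K u n)"
    using code_set(1)[of u n] by (auto simp: compact_imp_bounded bounded_imp_bdd_above bounded_imp_bdd_below)
  then have "x \<le> Sup (code_set K u n)" "y \<le> Sup (code_set K u n)"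
    "Inf (code_set K u n) \<le> x" "Inf (code_set K u n) \<le> y"
    using assms by (auto intro: cSup_upper cInf_lower)
  then show ?thesis
    using code_set_width[of u n] by linarith
qed

lemma decode_in_code_set: "decode K u \<in> code_set K u n"
proof -
  have "(\<Inter>n. code_set K u n) \<noteq> {}"
  proof (rule compact_nest)
    show "code_set K u n \<subseteq> code_set K u m" if "m \<le> n" for m n
      using lift_Suc_antimono_le[of "code_set K u", OF code_set_Suc_subset that] .
  qed (use code_set in auto)
  then obtain z where "z \<in> (\<Inter>n. code_set K u n)"
    by blast
  then have "decode K u \<in> (\<Inter>n. code_set K u n)"
    unfolding decode_def by (rule someI)
  then show ?thesis
    by blast
qed

lemma decode_in: "decode K u \<in> K"
  using decode_in_code_set[of u 0] by simp

text \<open>Sequences with a common prefix decode into the same code set, whose width is halved by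
  each digit.\<close>

lemma decode_continuous:
  assumes "e > 0"
  shows "\<exists>n. \<forall>u v. (\<forall>i<n. u i = v i) \<longrightarrow> \<bar>decode K u - decode K v\<bar> < e"
proof -
  have "(\<lambda>n. (Sup K - Inf K) * (1/2) ^ n) \<longlonglongrightarrow> (Sup K - Inf K) * 0"
    by (intro tendsto_mult_left LIMSEQ_power_zero) auto
  then have "\<forall>\<^sub>F n in sequentially. (Sup K - Inf K) * (1/2) ^ n < e"
    using assms order_tendstoD(2) by fastforce
  then obtain n where n: "(Sup K - Inf K) * (1/2) ^ n < e"
    by (auto simp: eventually_sequentially)
  have "\<bar>decode K u - decode K v\<bar> < e" if "\<forall>i<n. u i = v i" for u v
  proof -
    have "code_set K u m = code_set K v m" if "m \<le> n" for m
      using that by (induction m) (use \<open>\<forall>i<n. u i = v i\<close> in auto)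
    then have "decode K v \<in> code_set K u n"
      using decode_in_code_set[of v n] by simp
    then show ?thesis
      using code_set_dist[OF decode_in_code_set, of "decode K v" u n] n by linarith
  qed
  then show ?thesis
    by blast
qed

lemma decode_surj:
  assumes "x \<in> K"
  shows "\<exists>u. range u \<subseteq> {0, 1} \<and> decode K u = x"
proof -
  \<comment> \<open>Digits and code sets depend on each other. The sets are built first, always
    following a half that contains \<open>x\<close>, and the digits are read off them.\<close>
  define S where "S = rec_nat K (\<lambda>_ S. bisect S (if x \<le> (Inf S + Sup S) / 2 then 0 else 1))"
  define u where "u n = (if x \<le> (Inf (S n) + Sup (S n)) / 2 then 0 else 1 :: nat)" for n
  have S: "code_set K u n = S n" for n
    by (induction n) (simp_all add: S_def u_def)
  have x: "x \<in> code_set K u n" for n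
  proof (induction n)
    case (Suc n)
    have "u n = (if x \<le> (Inf (code_set K u n) + Sup (code_set K u n)) / 2 then 0 else 1)"
      by (simp only: S u_def)
    with Suc show ?case
      by (simp add: bisect_def del: le_divide_eq_numeral1 divide_le_eq_numeral1)
  qed (simp add: assms)
  have "\<bar>decode K u - x\<bar> \<le> 0"
  proof (rule LIMSEQ_le_const)
    have "(\<lambda>n. (Sup K - Inf K) * (1/2) ^ n) \<longlonglongrightarrow> (Sup K - Inf K) * 0"
      by (intro tendsto_mult_left LIMSEQ_power_zero) auto
    then show "(\<lambda>n. (Sup K - Inf K) * (1/2) ^ n) \<longlonglongrightarrow> 0"
      by simp
    show "\<exists>N. \<forall>n\<ge>N. \<bar>decode K u - x\<bar> \<le> (Sup K - Inf K) * (1/2) ^ n"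
      using code_set_dist[OF decode_in_code_set x] by blast
  qed
  then show ?thesis
    by (intro exI[of _ u]) (auto simp: u_def)
qed

end


section \<open>Uniformly convergent orbits of interval homeomorphisms\<close>

text \<open>A quantitative Cauchy condition. The weak inequality makes the set of all such
  \<open>y\<close> closed when the iterates are continuous.\<close>

definition tail_close :: "(real \<Rightarrow> real) \<Rightarrow> real \<Rightarrow> nat \<Rightarrow> real \<Rightarrow> bool" where
  "tail_close f y n e \<longleftrightarrow> (\<forall>m\<ge>n. \<forall>k\<ge>n. \<bar>(f ^^ m) y - (f ^^ k) y\<bar> \<le> e)"

lemma tail_close_mono: "tail_close f y n e \<Longrightarrow> n \<le> n' \<Longrightarrow> tail_close f y n' e"
  by (meson order_trans tail_close_def)

text \<open>The inverse is a parameter with the same properties as \<open>H\<close>, so each result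
  also holds backward in time by \<open>interval_homeo_inverse\<close>.\<close>

locale interval_homeo =
  fixes H Hi :: "real \<Rightarrow> real" and a b :: real
  assumes ab: "a \<le> b"
    and mono: "\<And>x y. a \<le> x \<Longrightarrow> x \<le> y \<Longrightarrow> y \<le> b \<Longrightarrow> H x \<le> H y"
    and mono_inv: "\<And>x y. a \<le> x \<Longrightarrow> x \<le> y \<Longrightarrow> y \<le> b \<Longrightarrow> Hi x \<le> Hi y"
    and cont: "continuous_on {a..b} H"
    and cont_inv: "continuous_on {a..b} Hi"
    and ends [simp]: "H a = a" "H b = b"
    and ends_inv [simp]: "Hi a = a" "Hi b = b"
    and H_Hi: "\<And>x. x \<in> {a..b} \<Longrightarrow> H (Hi x) = x"
    and Hi_H: "\<And>x. x \<in> {a..b} \<Longrightarrow> Hi (H x) = x"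
begin

lemma interval_homeo_inverse: "interval_homeo Hi H a b"
  by unfold_locales (auto simp: ab mono mono_inv cont cont_inv H_Hi Hi_H)

lemma in_interval: "x \<in> {a..b} \<Longrightarrow> H x \<in> {a..b}"
  using mono[of a x] mono[of x b] by simp

lemma funpow_in_interval: "x \<in> {a..b} \<Longrightarrow> (H ^^ n) x \<in> {a..b}"
  using in_interval by (induction n) auto

lemma funpow_mono: "a \<le> x \<Longrightarrow> x \<le> y \<Longrightarrow> y \<le> b \<Longrightarrow> (H ^^ n) x \<le> (H ^^ n) y"
proof (induction n)
  case (Suc n)
  then show ?case
    using funpow_in_interval[of x n] funpow_in_interval[of y n] by (simp add: mono)
qed simp

lemma continuous_on_funpow: "continuous_on {a..b} (H ^^ n)"
proof (induction n)
  case (Suc n)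
  have "continuous_on ((H ^^ n) ` {a..b}) H"
    using funpow_in_interval by (intro continuous_on_subset[OF cont]) blast
  then show ?case
    using continuous_on_compose[OF Suc] by simp
qed (simp add: continuous_on_id)

lemma inv_funpow: "x \<in> {a..b} \<Longrightarrow> (H ^^ n) ((Hi ^^ n) x) = x"
proof (induction n arbitrary: x)
  case (Suc n)
  interpret inv: interval_homeo Hi H a b
    by (rule interval_homeo_inverse)
  have "(H ^^ Suc n) ((Hi ^^ Suc n) x) = (H ^^ n) (H (Hi ((Hi ^^ n) x)))"
    by (simp add: funpow_swap1)
  then show ?case
    using Suc inv.funpow_in_interval[of x n] by (simp only: H_Hi)
qed simp

lemma orbit_monoseq: "x \<in> {a..b} \<Longrightarrow> monoseq (\<lambda>n. (H ^^ n) x)"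
proof (cases "x \<le> H x")
  case True
  assume x: "x \<in> {a..b}"
  have "(H ^^ n) x \<le> (H ^^ Suc n) x" for n
    using funpow_mono[of x "H x" n] x True in_interval[OF x] by (simp add: funpow_swap1)
  then show ?thesis
    by (intro mono_SucI1) auto
next
  case False
  assume x: "x \<in> {a..b}"
  have "(H ^^ Suc n) x \<le> (H ^^ n) x" for n
    using funpow_mono[of "H x" x n] x False in_interval[OF x] by (simp add: funpow_swap1)
  then show ?thesis
    by (intro mono_SucI2) auto
qed

lemma orbit_convergent: "x \<in> {a..b} \<Longrightarrow> convergent (\<lambda>n. (H ^^ n) x)"
proof -
  assume x: "x \<in> {a..b}"
  have "\<bar>(H ^^ n) x\<bar> \<le> max \<bar>a\<bar> \<bar>b\<bar>" for n
    using funpow_in_interval[OF x, of n] by auto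
  then have "Bseq (\<lambda>n. (H ^^ n) x)"
    by (intro BseqI'[of _ "max \<bar>a\<bar> \<bar>b\<bar>"]) simp
  then show ?thesis
    using orbit_monoseq[OF x] by (rule Bseq_monoseq_convergent)
qed

lemma orbit_limit_fixed:
  assumes "x \<in> {a..b}" "(\<lambda>n. (H ^^ n) x) \<longlonglongrightarrow> l"
  shows "l \<in> {a..b}" "H l = l"
proof -
  show l: "l \<in> {a..b}"
    using closed_sequentially[OF closed_atLeastAtMost _ assms(2)] funpow_in_interval[OF assms(1)] by blast
  have "(\<lambda>n. H ((H ^^ n) x)) \<longlonglongrightarrow> H l"
    using continuous_on_tendsto_compose[OF cont assms(2) l] funpow_in_interval[OF assms(1)] by simp
  moreover have "(\<lambda>n. H ((H ^^ n) x)) \<longlonglongrightarrow> l"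
    using LIMSEQ_Suc[OF assms(2)] by simp
  ultimately show "H l = l"
    using LIMSEQ_unique by blast
qed

lemma eventually_tail_close:
  assumes "x \<in> {a..b}" "e > 0"
  shows "\<forall>\<^sub>F n in sequentially. tail_close H x n e"
proof -
  have "Cauchy (\<lambda>n. (H ^^ n) x)"
    using orbit_convergent[OF assms(1)] by (rule convergent_Cauchy)
  then obtain M where "\<And>m k. m \<ge> M \<Longrightarrow> k \<ge> M \<Longrightarrow> dist ((H ^^ m) x) ((H ^^ k) x) < e"
    using assms(2) metric_CauchyD by blast
  then have "tail_close H x M e"
    unfolding tail_close_def dist_real_def by (meson less_imp_le)
  then show ?thesis
    unfolding eventually_sequentially using tail_close_mono by blast
qed

text \<open>The orbit of \<open>z\<close> is squeezed between the orbit of \<open>c\<close> and the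
  same orbit shifted by one step; the shift costs the \<open>Suc\<close>.\<close>

lemma tail_close_between:
  assumes "a \<le> c" "c \<le> z" "z \<le> H c" "c \<le> b"
    and "tail_close H c n e" "tail_close Hi c n e"
  shows "tail_close H z (Suc n) e" "tail_close Hi z (Suc n) e"
proof -
  interpret inv: interval_homeo Hi H a b
    by (rule interval_homeo_inverse)
  have c: "c \<in> {a..b}" and Hc: "H c \<in> {a..b}"
    using assms in_interval by auto
  have H: "(H ^^ m) c \<le> (H ^^ m) z" "(H ^^ m) z \<le> (H ^^ Suc m) c" for m
    using funpow_mono[of c z m] funpow_mono[of z "H c" m] assms Hc by (auto simp: funpow_swap1)
  show "tail_close H z (Suc n) e"
    unfolding tail_close_def
  proof (intro allI impI)
    fix m k assume "m \<ge> Suc n" "k \<ge> Suc n"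
    then have "\<bar>(H ^^ Suc m) c - (H ^^ k) c\<bar> \<le> e" "\<bar>(H ^^ Suc k) c - (H ^^ m) c\<bar> \<le> e"
      using assms(5) unfolding tail_close_def by (meson Suc_leD le_SucI)+
    then show "\<bar>(H ^^ m) z - (H ^^ k) z\<bar> \<le> e"
      using H[of m] H[of k] by linarith
  qed
  have Hi: "(Hi ^^ Suc m) c \<le> (Hi ^^ Suc m) z" "(Hi ^^ Suc m) z \<le> (Hi ^^ m) c" for m
    using inv.funpow_mono[of c z "Suc m"] inv.funpow_mono[of z "H c" "Suc m"] assms Hc Hi_H[OF c]
    by (auto simp: funpow_swap1)
  show "tail_close Hi z (Suc n) e"
    unfolding tail_close_def
  proof (intro allI impI)
    fix m' k' assume "m' \<ge> Suc n" "k' \<ge> Suc n"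
    then obtain m k where mk: "m' = Suc m" "k' = Suc k" "m \<ge> n" "k \<ge> n"
      by (metis Suc_le_D Suc_le_mono)
    then have "\<bar>(Hi ^^ m) c - (Hi ^^ Suc k) c\<bar> \<le> e" "\<bar>(Hi ^^ k) c - (Hi ^^ Suc m) c\<bar> \<le> e"
      using assms(6) unfolding tail_close_def by (meson le_SucI)+
    then show "\<bar>(Hi ^^ m') z - (Hi ^^ k') z\<bar> \<le> e"
      using Hi[of m] Hi[of k] unfolding mk by linarith
  qed
qed

text \<open>The orbit of \<open>x\<close> visits the fundamental domain \<open>[c, H c]\<close> of every \<open>c\<close> that lies between the
  two limits of the orbit.\<close>

lemma orbit_up:
  assumes x: "x \<in> {a..b}" "x < H x"
  obtains \<alpha> \<beta> where "a \<le> \<alpha>" "\<alpha> < \<beta>" "\<beta> \<le> b" "H \<alpha> = \<alpha>" "H \<beta> = \<beta>"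
    "\<And>c. \<alpha> < c \<Longrightarrow> c < \<beta> \<Longrightarrow>
      \<exists>z. c \<le> z \<and> z \<le> H c \<and> \<alpha> \<le> z \<and> z \<le> \<beta> \<and> (\<exists>n. x = (H ^^ n) z \<or> x = (Hi ^^ n) z)"
proof -
  interpret inv: interval_homeo Hi H a b
    by (rule interval_homeo_inverse)
  obtain \<alpha> \<beta> where lim: "(\<lambda>n. (H ^^ n) x) \<longlonglongrightarrow> \<beta>" "(\<lambda>n. (Hi ^^ n) x) \<longlonglongrightarrow> \<alpha>"
    using orbit_convergent[OF x(1)] inv.orbit_convergent[OF x(1)] by (auto simp: convergent_def)
  have fix_\<beta>: "\<beta> \<in> {a..b}" "H \<beta> = \<beta>"
    using orbit_limit_fixed[OF x(1) lim(1)] by auto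
  have fix_\<alpha>: "\<alpha> \<in> {a..b}" "Hi \<alpha> = \<alpha>"
    using inv.orbit_limit_fixed[OF x(1) lim(2)] by auto
  then have "H \<alpha> = \<alpha>"
    using H_Hi by metis
  have up: "(H ^^ n) x \<le> (H ^^ Suc n) x" for n
    using funpow_mono[of x "H x" n] x in_interval[OF x(1)] by (simp add: funpow_swap1)
  then have "incseq (\<lambda>n. (H ^^ n) x)"
    by (rule incseq_SucI)
  then have le_\<beta>: "(H ^^ n) x \<le> \<beta>" for n
    using lim(1) by (rule incseq_le)
  have "Hi x \<le> x"
    using mono_inv[of x "H x"] x in_interval[OF x(1)] Hi_H[OF x(1)] by simp
  then have "(Hi ^^ Suc n) x \<le> (Hi ^^ n) x" for n
    using inv.funpow_mono[of "Hi x" x n] x(1) inv.in_interval[OF x(1)] by (simp add: funpow_swap1)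
  then have "decseq (\<lambda>n. (Hi ^^ n) x)"
    by (rule decseq_SucI)
  then have ge_\<alpha>: "\<alpha> \<le> (Hi ^^ n) x" for n
    using lim(2) by (rule decseq_ge)
  have "\<alpha> < \<beta>"
    using ge_\<alpha>[of 0] le_\<beta>[of 1] x(2) by simp
  have "\<exists>z. c \<le> z \<and> z \<le> H c \<and> \<alpha> \<le> z \<and> z \<le> \<beta> \<and> (\<exists>n. x = (H ^^ n) z \<or> x = (Hi ^^ n) z)"
    if c: "\<alpha> < c" "c < \<beta>" for c
  proof -
    obtain m where m: "(Hi ^^ m) x < c"
      using order_tendstoD(2)[OF lim(2) c(1)] by (auto simp: eventually_sequentially)
    obtain k where k: "(H ^^ k) x > c"
      using order_tendstoD(1)[OF lim(1) c(2)] by (auto simp: eventually_sequentially)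
    define w where "w = (Hi ^^ m) x"
    have w: "w \<in> {a..b}"
      unfolding w_def by (rule inv.funpow_in_interval[OF x(1)])
    have Hw: "(H ^^ m) w = x"
      unfolding w_def by (rule inv_funpow[OF x(1)])
    have "(H ^^ (k + m)) w \<ge> c"
      using k by (simp add: funpow_add Hw)
    \<comment> \<open>First passage: the iterate before time \<open>n\<close> is still below
      \<open>c\<close>, so \<open>z\<close> cannot lie beyond \<open>H c\<close>.\<close>
    define n where "n = (LEAST n. (H ^^ n) w \<ge> c)"
    define z where "z = (H ^^ n) w"
    have "c \<le> z"
      unfolding z_def n_def by (rule LeastI[of "\<lambda>n. (H ^^ n) w \<ge> c"]) fact
    then have "n \<noteq> 0"
      using m by (auto simp: z_def w_def intro: ccontr)
    then obtain n' where n': "n = Suc n'"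
      using not0_implies_Suc by blast
    then have "(H ^^ n') w < c"
      using not_less_Least[of n' "\<lambda>n. (H ^^ n) w \<ge> c"] by (simp add: n_def)
    then have "z \<le> H c"
      unfolding z_def n' using mono[of "(H ^^ n') w" c] funpow_in_interval[OF w, of n'] c fix_\<beta>(1) by simp
    have z: "z \<in> {a..b}"
      unfolding z_def by (rule funpow_in_interval[OF w])
    have "z \<le> \<beta>"
      using \<open>z \<le> H c\<close> mono[of c \<beta>] c fix_\<alpha>(1) fix_\<beta> by simp
    \<comment> \<open>Both \<open>x\<close> and \<open>z\<close> are forward iterates of
      \<open>w\<close>, at times \<open>m\<close> and \<open>n\<close>; their order decides between
      \<open>H\<close> and \<open>Hi\<close>.\<close>
    moreover have "\<exists>j. x = (H ^^ j) z \<or> x = (Hi ^^ j) z"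
    proof (cases "n \<le> m")
      case True
      have "(H ^^ (m - n)) z = (H ^^ (m - n + n)) w"
        unfolding z_def by (simp add: funpow_add)
      then show ?thesis
        using True Hw by auto
    next
      case False
      have "z = (H ^^ (n - m)) x"
        unfolding z_def Hw[symmetric] using False by (simp flip: funpow_add comp_apply[of "H ^^ _"])
      then have "x = (Hi ^^ (n - m)) z"
        using inv.inv_funpow[OF x(1)] by simp
      then show ?thesis
        by blast
    qed
    ultimately show ?thesis
      using \<open>c \<le> z\<close> \<open>z \<le> H c\<close> c by (intro exI[of _ z]) auto
  qed
  then show ?thesis
    using that[of \<alpha> \<beta>] fix_\<alpha> fix_\<beta> \<open>\<alpha> < \<beta>\<close> \<open>H \<alpha> = \<alpha>\<close> by simp
qed

lemma funpow_between_fixed: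
  assumes "a \<le> \<alpha>" "\<beta> \<le> b" "H \<alpha> = \<alpha>" "H \<beta> = \<beta>" "\<alpha> \<le> z" "z \<le> \<beta>"
  shows "\<alpha> \<le> (H ^^ n) z \<and> (H ^^ n) z \<le> \<beta>"
proof (induction n)
  case (Suc n)
  then show ?case
    using mono[of \<alpha> "(H ^^ n) z"] mono[of "(H ^^ n) z" \<beta>] assms by simp
qed (use assms in simp)

text \<open>An orbit never leaves the interval between two fixed points, so a short interval bounds
  its oscillation from the start.\<close>

lemma tail_close_narrow:
  assumes "a \<le> \<alpha>" "\<beta> \<le> b" "H \<alpha> = \<alpha>" "H \<beta> = \<beta>" "\<alpha> \<le> z" "z \<le> \<beta>" "\<beta> - \<alpha> \<le> e"
  shows "tail_close H z n e"
  unfolding tail_close_def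
proof (intro allI impI)
  fix m k
  show "\<bar>(H ^^ m) z - (H ^^ k) z\<bar> \<le> e"
    using funpow_between_fixed[OF assms(1-6), of m] funpow_between_fixed[OF assms(1-6), of k] assms(7)
    by linarith
qed

text \<open>The net \<open>E N\<close> meets every subinterval longer than \<open>1 / (N + 1)\<close>, and the rate \<open>r N\<close> applies to
  all nets up to \<open>E N\<close>. In each complementary interval of the fixed point set we take the
  fundamental domain of a net point of the least possible level.\<close>

lemma orbit_representative_up:
  fixes E :: "nat \<Rightarrow> real set" and r :: "nat \<Rightarrow> nat"
  assumes x: "x \<in> {a..b}" "x < H x"
    and E: "\<And>N \<alpha> \<beta>. a \<le> \<alpha> \<Longrightarrow> \<beta> \<le> b \<Longrightarrow> \<beta> - \<alpha> > 1 / real (Suc N) \<Longrightarrow> \<exists>c\<in>E N. \<alpha> < c \<and> c < \<beta>"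
    and r: "\<And>N l c. l \<le> N \<Longrightarrow> c \<in> E l \<Longrightarrow>
      tail_close H c (r N) (1 / real (Suc N)) \<and> tail_close Hi c (r N) (1 / real (Suc N))"
  shows "\<exists>z\<in>{a..b}. (\<forall>N. tail_close H z (Suc (r N)) (1 / real (Suc N)) \<and> tail_close Hi z (Suc (r N)) (1 / real (Suc N)))
    \<and> (\<exists>n. x = (H ^^ n) z \<or> x = (Hi ^^ n) z)"
proof -
  interpret inv: interval_homeo Hi H a b
    by (rule interval_homeo_inverse)
  obtain \<alpha> \<beta> where \<alpha>\<beta>: "a \<le> \<alpha>" "\<alpha> < \<beta>" "\<beta> \<le> b" "H \<alpha> = \<alpha>" "H \<beta> = \<beta>"
    and z_ex: "\<And>c. \<alpha> < c \<Longrightarrow> c < \<beta> \<Longrightarrow>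
      \<exists>z. c \<le> z \<and> z \<le> H c \<and> \<alpha> \<le> z \<and> z \<le> \<beta> \<and> (\<exists>n. x = (H ^^ n) z \<or> x = (Hi ^^ n) z)"
    using orbit_up[OF x] by metis
  have inv_fixed: "Hi \<alpha> = \<alpha>" "Hi \<beta> = \<beta>"
    using Hi_H[of \<alpha>] Hi_H[of \<beta>] \<alpha>\<beta> by auto
  define L where "L = (LEAST l. \<exists>c\<in>E l. \<alpha> < c \<and> c < \<beta>)"
  obtain N0 where "1 / real (Suc N0) < \<beta> - \<alpha>"
    using reals_Archimedean[of "\<beta> - \<alpha>"] \<alpha>\<beta>(2) by (auto simp: inverse_eq_divide)
  then have "\<exists>c\<in>E N0. \<alpha> < c \<and> c < \<beta>"
    using E \<alpha>\<beta> by blast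
  then have "\<exists>c\<in>E L. \<alpha> < c \<and> c < \<beta>"
    unfolding L_def by (rule LeastI[of "\<lambda>l. \<exists>c\<in>E l. \<alpha> < c \<and> c < \<beta>"])
  then obtain c where c: "c \<in> E L" "\<alpha> < c" "c < \<beta>"
    by blast
  obtain z where z: "c \<le> z" "z \<le> H c" "\<alpha> \<le> z" "z \<le> \<beta>" "\<exists>n. x = (H ^^ n) z \<or> x = (Hi ^^ n) z"
    using z_ex[OF c(2,3)] by blast
  \<comment> \<open>If the gap is short at level \<open>N\<close>, confinement is enough. Otherwise
    \<open>E N\<close> meets the gap, so \<open>L \<le> N\<close> by minimality and the rate
    \<open>r N\<close> is valid for \<open>c\<close>.\<close>
  have "tail_close H z (Suc (r N)) (1 / real (Suc N)) \<and> tail_close Hi z (Suc (r N)) (1 / real (Suc N))" for N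
  proof (cases "\<beta> - \<alpha> \<le> 1 / real (Suc N)")
    case True
    then show ?thesis
      using tail_close_narrow[OF \<alpha>\<beta>(1,3-5) z(3,4)] inv.tail_close_narrow[OF \<alpha>\<beta>(1,3) inv_fixed z(3,4)]
      by blast
  next
    case False
    then have "\<exists>c\<in>E N. \<alpha> < c \<and> c < \<beta>"
      using E \<alpha>\<beta> by (simp add: not_le)
    then have "L \<le> N"
      unfolding L_def by (rule Least_le)
    then show ?thesis
      using tail_close_between[of c z] r[OF _ c(1)] z c \<alpha>\<beta> by auto
  qed
  moreover have "z \<in> {a..b}"
    using z \<alpha>\<beta> by auto
  ultimately show ?thesis
    using z(5) by blast
qed

lemma finite_nets_exist:
  obtains E :: "nat \<Rightarrow> real set" where "\<And>N. finite (E N)" "\<And>N. E N \<subseteq> {a..b}"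
    "\<And>N \<alpha> \<beta>. a \<le> \<alpha> \<Longrightarrow> \<beta> \<le> b \<Longrightarrow> \<beta> - \<alpha> > 1 / real (Suc N) \<Longrightarrow> \<exists>c\<in>E N. \<alpha> < c \<and> c < \<beta>"
proof -
  \<comment> \<open>The radius is half of \<open>1 / real (Suc N)\<close>: a net point that close to
    the midpoint of a longer interval lies inside it.\<close>
  have "\<exists>k. finite k \<and> k \<subseteq> {a..b} \<and> {a..b} \<subseteq> (\<Union>x\<in>k. ball x (1 / (2 * real (Suc N))))" for N
    using compact_imp_seq_compact[OF compact_Icc[of a b]] seq_compact_imp_totally_bounded[of "{a..b}"]
    by (metis mult_pos_pos of_nat_0_less_iff zero_less_Suc zero_less_divide_1_iff zero_less_numeral)
  then obtain E where E: "\<And>N. finite (E N)" "\<And>N. E N \<subseteq> {a..b}"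
      "\<And>N. {a..b} \<subseteq> (\<Union>x\<in>E N. ball x (1 / (2 * real (Suc N))))"
    by metis
  have "\<exists>c\<in>E N. \<alpha> < c \<and> c < \<beta>" if "a \<le> \<alpha>" "\<beta> \<le> b" "\<beta> - \<alpha> > 1 / real (Suc N)" for N \<alpha> \<beta>
  proof -
    have "1 / real (Suc N) > 0"
      by simp
    then have "\<alpha> < \<beta>"
      using that(3) by linarith
    then have "(\<alpha> + \<beta>) / 2 \<in> {a..b}"
      using that by auto
    then have "(\<alpha> + \<beta>) / 2 \<in> (\<Union>x\<in>E N. ball x (1 / (2 * real (Suc N))))"
      using E(3) by blast
    then obtain c where c: "c \<in> E N" "dist c ((\<alpha> + \<beta>) / 2) < 1 / (2 * real (Suc N))"
      unfolding UN_iff mem_ball by blast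
    define e where "e = 1 / real (Suc N)"
    have "1 / (2 * real (Suc N)) = e / 2"
      by (simp add: e_def)
    then have "\<bar>c - (\<alpha> + \<beta>) / 2\<bar> < e / 2"
      using c(2) by (simp only: dist_real_def)
    moreover have "e < \<beta> - \<alpha>"
      using that(3) by (simp only: e_def)
    ultimately have "\<alpha> < c" "c < \<beta>"
      unfolding abs_less_iff by (simp_all add: field_simps)
    then show ?thesis
      using c(1) by blast
  qed
  then show ?thesis
    using that[of E] E by blast
qed

text \<open>The set \<open>K\<close> consists of all points whose forward and backward orbits
  converge at a prescribed rate, which makes it closed. The work lies in choosing a rate slow enough
  for \<open>K\<close> to meet every orbit.\<close>

lemma uniform_orbit_representatives:
  obtains K r where "compact K" "K \<noteq> {}" "K \<subseteq> {a..b}"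
    "\<And>N y. y \<in> K \<Longrightarrow> tail_close H y (r N) (1 / real (Suc N))"
    "\<And>N y. y \<in> K \<Longrightarrow> tail_close Hi y (r N) (1 / real (Suc N))"
    "\<And>x. x \<in> {a..b} \<Longrightarrow> \<exists>y\<in>K. \<exists>n. x = (H ^^ n) y \<or> x = (Hi ^^ n) y"
proof -
  interpret inv: interval_homeo Hi H a b
    by (rule interval_homeo_inverse)
  obtain E :: "nat \<Rightarrow> real set" where E: "\<And>N. finite (E N)" "\<And>N. E N \<subseteq> {a..b}"
    "\<And>N \<alpha> \<beta>. a \<le> \<alpha> \<Longrightarrow> \<beta> \<le> b \<Longrightarrow> \<beta> - \<alpha> > 1 / real (Suc N) \<Longrightarrow> \<exists>c\<in>E N. \<alpha> < c \<and> c < \<beta>"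
    using finite_nets_exist by metis
  \<comment> \<open>The levels up to \<open>N\<close> contain finitely many points altogether, so a
    single time serves all of them.\<close>
  have "\<exists>n. \<forall>c\<in>(\<Union>l\<le>N. E l). tail_close H c n (1 / real (Suc N)) \<and> tail_close Hi c n (1 / real (Suc N))" for N
  proof -
    have "\<forall>\<^sub>F n in sequentially. \<forall>c\<in>(\<Union>l\<le>N. E l).
        tail_close H c n (1 / real (Suc N)) \<and> tail_close Hi c n (1 / real (Suc N))"
    proof (intro eventually_ball_finite ballI eventually_conj)
      fix c assume "c \<in> (\<Union>l\<le>N. E l)"
      then have "c \<in> {a..b}"
        using E(2) by blast
      then show "\<forall>\<^sub>F n in sequentially. tail_close H c n (1 / real (Suc N))"
        "\<forall>\<^sub>F n in sequentially. tail_close Hi c n (1 / real (Suc N))"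
        by (auto intro: eventually_tail_close inv.eventually_tail_close)
    qed (use E(1) in simp)
    then show ?thesis
      by (rule eventually_happens'[rotated]) simp
  qed
  then obtain r where r: "\<And>N c. c \<in> (\<Union>l\<le>N. E l) \<Longrightarrow>
      tail_close H c (r N) (1 / real (Suc N)) \<and> tail_close Hi c (r N) (1 / real (Suc N))"
    by metis
  have r': "tail_close H c (r N) (1 / real (Suc N)) \<and> tail_close Hi c (r N) (1 / real (Suc N))"
    if "l \<le> N" "c \<in> E l" for N l c
    using r that by blast
  define K where "K = {y \<in> {a..b}. \<forall>N. tail_close H y (Suc (r N)) (1 / real (Suc N)) \<and> tail_close Hi y (Suc (r N)) (1 / real (Suc N))}"
  have closed_tail: "closed {y \<in> {a..b}. tail_close f y n e}"
    if "\<And>m. continuous_on {a..b} (f ^^ m)" for f n e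
  proof -
    have "closed {y \<in> {a..b}. \<bar>(f ^^ m) y - (f ^^ k) y\<bar> \<le> e}" for m k
      by (intro continuous_on_closed_Collect_le continuous_intros that closed_atLeastAtMost)
    then have "closed ({a..b} \<inter> (\<Inter>m\<in>{n..}. \<Inter>k\<in>{n..}. {y \<in> {a..b}. \<bar>(f ^^ m) y - (f ^^ k) y\<bar> \<le> e}))"
      by (intro closed_Int closed_INT ballI closed_atLeastAtMost)
    moreover have "{a..b} \<inter> (\<Inter>m\<in>{n..}. \<Inter>k\<in>{n..}. {y \<in> {a..b}. \<bar>(f ^^ m) y - (f ^^ k) y\<bar> \<le> e}) = {y \<in> {a..b}. tail_close f y n e}"
      by (auto simp: tail_close_def)
    ultimately show ?thesis
      by simp
  qed
  have "K = (\<Inter>N. {y \<in> {a..b}. tail_close H y (Suc (r N)) (1 / real (Suc N))} \<inter> {y \<in> {a..b}. tail_close Hi y (Suc (r N)) (1 / real (Suc N))})"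
    by (auto simp: K_def)
  moreover have "closed \<dots>"
    by (intro closed_INT closed_Int ballI closed_tail continuous_on_funpow inv.continuous_on_funpow)
  ultimately have "closed K"
    by simp
  moreover have sub: "K \<subseteq> {a..b}"
    by (auto simp: K_def)
  ultimately have "compact K"
    by (meson bounded_closed_interval bounded_subset compact_eq_bounded_closed)
  \<comment> \<open>Fixed points have constant orbits. Through the endpoint \<open>a\<close> this
    also makes \<open>K\<close> nonempty.\<close>
  have fixed: "x \<in> K" if "x \<in> {a..b}" "H x = x" for x
  proof -
    have "Hi x = x"
      using Hi_H that by metis
    then have "tail_close H x n (1 / real (Suc N))" "tail_close Hi x n (1 / real (Suc N))" for n N
      using tail_close_narrow[of x x x] inv.tail_close_narrow[of x x x] that by auto
    then show ?thesis
      using that(1) by (simp add: K_def)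
  qed
  have "\<exists>y\<in>K. \<exists>n. x = (H ^^ n) y \<or> x = (Hi ^^ n) y" if x: "x \<in> {a..b}" for x
  proof (cases "H x" x rule: linorder_cases)
    case equal
    then show ?thesis
      using fixed[OF x] by (intro bexI[of _ x] exI[of _ 0]) auto
  next
    case greater
    have "\<exists>z\<in>{a..b}. (\<forall>N. tail_close H z (Suc (r N)) (1 / real (Suc N)) \<and> tail_close Hi z (Suc (r N)) (1 / real (Suc N)))
        \<and> (\<exists>n. x = (H ^^ n) z \<or> x = (Hi ^^ n) z)"
      by (rule orbit_representative_up[of x E r]) (use x greater E(3) r' in blast)+
    then show ?thesis
      unfolding K_def by blast
  next
    case less
    \<comment> \<open>A point moved down by \<open>H\<close> is moved up by \<open>Hi\<close>, so
      \<open>orbit_representative_up\<close> applies to the inverse.\<close>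
    have "x < Hi x"
    proof (rule ccontr)
      assume "\<not> x < Hi x"
      then have "H (Hi x) \<le> H x"
        using mono[of "Hi x" x] x inv.in_interval[OF x] by simp
      then show False
        using less H_Hi[OF x] by simp
    qed
    then have "\<exists>z\<in>{a..b}. (\<forall>N. tail_close Hi z (Suc (r N)) (1 / real (Suc N)) \<and> tail_close H z (Suc (r N)) (1 / real (Suc N)))
        \<and> (\<exists>n. x = (Hi ^^ n) z \<or> x = (H ^^ n) z)"
      by (intro inv.orbit_representative_up[of x E r]) (use x E(3) r' in blast)+
    then show ?thesis
      unfolding K_def by blast
  qed
  then show ?thesis
    using that[of K "\<lambda>N. Suc (r N)"] \<open>compact K\<close> sub fixed[of a] ab by (auto simp: K_def)
qed

end


section \<open>Reading an integer time off an input and an output tape\<close>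

text \<open>The length of the initial block of \<open>c\<close>, cut off at \<open>n\<close> so that
  it makes sense for a constant sequence too.\<close>

fun lead :: "'a \<Rightarrow> nat \<Rightarrow> (nat \<Rightarrow> 'a) \<Rightarrow> nat" where
  "lead c 0 u = 0"
| "lead c (Suc n) u = (if u 0 = c then Suc (lead c n (\<lambda>i. u (Suc i))) else 0)"

lemma lead_truncate: "m \<le> n \<Longrightarrow> lead c m u = min m (lead c n u)"
proof (induction m arbitrary: n u)
  case (Suc m)
  then obtain n' where "n = Suc n'" "m \<le> n'"
    by (metis Suc_le_D Suc_le_mono)
  then show ?case
    using Suc.IH by simp
qed simp

lemma lead_cong: "(\<And>i. i < n \<Longrightarrow> u i = v i) \<Longrightarrow> lead c n u = lead c n v"
proof (induction n arbitrary: u v)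
  case (Suc n)
  show ?case
    using Suc.prems[of 0] Suc.IH[of "\<lambda>i. u (Suc i)" "\<lambda>i. v (Suc i)"] Suc.prems by simp
qed simp

lemma lead_le: "lead c n u \<le> n"
  by (induction n arbitrary: u) auto

lemma lead_eq_0: "u 0 \<noteq> c \<Longrightarrow> lead c n u = 0"
  by (cases n) auto

lemma lead_block: "c \<noteq> d \<Longrightarrow> lead c n (\<lambda>i. if i < j then c else d) = min n j"
proof (induction n arbitrary: j)
  case (Suc n)
  show ?case
  proof (cases j)
    case (Suc j')
    then show ?thesis
      using Suc.IH[OF Suc.prems, of j'] by simp
  qed (use Suc.prems in simp)
qed simp

text \<open>Raising the cutoff either leaves the count unchanged, or both counts are at least
  \<open>r\<close> and the orbit has already settled.\<close>

lemma tail_close_lead: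
  assumes "tail_close f y r e" "m \<ge> r" "n \<ge> r" "e \<ge> 0"
  shows "\<bar>(f ^^ lead c m u) y - (f ^^ lead c n u) y\<bar> \<le> e"
proof -
  have "\<bar>(f ^^ lead c m u) y - (f ^^ lead c n u) y\<bar> \<le> e" if "r \<le> m" "m \<le> n" for m n
  proof (cases "lead c n u \<le> m")
    case True
    then show ?thesis
      using lead_truncate[OF that(2), of c u] assms(4) by simp
  next
    case False
    then have "lead c m u = m" "lead c n u \<ge> r"
      using lead_truncate[OF that(2), of c u] that(1) by auto
    then show ?thesis
      using assms(1) that(1) by (simp add: tail_close_def)
  qed
  then show ?thesis
    using assms(2,3) by (cases "m \<le> n") (simp, metis abs_minus_commute nat_le_linear)
qed

text \<open>The input tape \<open>0\<^sup>n1\<dots>\<close> with \<open>n > 0\<close> stands for time \<open>- n\<close>; once its head is not \<open>0\<close>, the output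
  tape \<open>1\<^sup>m0\<dots>\<close> stands for time \<open>m\<close>. While the input is read, zeros are pushed on the output tape, so that
  the count starts from \<open>0\<close>.\<close>

definition truncated_orbit ::
  "(real \<Rightarrow> real) \<Rightarrow> (real \<Rightarrow> real) \<Rightarrow> nat \<Rightarrow> real \<Rightarrow> (nat \<Rightarrow> nat) \<Rightarrow> (nat \<Rightarrow> nat) \<Rightarrow> real" where
  "truncated_orbit H Hi n y s w = (if s 0 = 0 then (Hi ^^ lead 0 n s) y else (H ^^ lead 1 n w) y)"

text \<open>For a finite block the truncations are eventually constant. An infinite block stands for
  time \<open>\<infinity>\<close> or \<open>-\<infinity>\<close>, and the limit is then the end of
  the orbit.\<close>

definition orbit_point ::
  "(real \<Rightarrow> real) \<Rightarrow> (real \<Rightarrow> real) \<Rightarrow> real \<Rightarrow> (nat \<Rightarrow> nat) \<Rightarrow> (nat \<Rightarrow> nat) \<Rightarrow> real" where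
  "orbit_point H Hi y s w = lim (\<lambda>n. truncated_orbit H Hi n y s w)"

locale uniform_orbits = interval_homeo +
  fixes K :: "real set" and r :: "nat \<Rightarrow> nat"
  assumes compact: "compact K" "K \<noteq> {}" "K \<subseteq> {a..b}"
    and tail: "\<And>N y. y \<in> K \<Longrightarrow> tail_close H y (r N) (1 / real (Suc N))"
    and tail_inv: "\<And>N y. y \<in> K \<Longrightarrow> tail_close Hi y (r N) (1 / real (Suc N))"
    and covers: "\<And>x. x \<in> {a..b} \<Longrightarrow> \<exists>y\<in>K. \<exists>n. x = (H ^^ n) y \<or> x = (Hi ^^ n) y"
begin

abbreviation "trunc \<equiv> truncated_orbit H Hi"
abbreviation "point \<equiv> orbit_point H Hi"

sublocale inv: interval_homeo Hi H a b
  by (rule interval_homeo_inverse)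

lemma trunc_in_interval: "y \<in> K \<Longrightarrow> trunc n y s w \<in> {a..b}"
  using funpow_in_interval[of y] inv.funpow_in_interval[of y] compact(3)
  unfolding truncated_orbit_def by (auto simp del: atLeastAtMost_iff)

lemma trunc_close:
  "y \<in> K \<Longrightarrow> m \<ge> r N \<Longrightarrow> n \<ge> r N \<Longrightarrow> \<bar>trunc m y s w - trunc n y s w\<bar> \<le> 1 / real (Suc N)"
  using tail_close_lead[OF tail, of y N m n 1 w] tail_close_lead[OF tail_inv, of y N m n 0 s]
  by (simp add: truncated_orbit_def)

lemma trunc_LIMSEQ: "y \<in> K \<Longrightarrow> (\<lambda>n. trunc n y s w) \<longlonglongrightarrow> point y s w"
proof -
  assume y: "y \<in> K"
  have "Cauchy (\<lambda>n. trunc n y s w)"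
  proof (rule metric_CauchyI)
    fix e :: real assume "e > 0"
    then obtain N where N: "1 / real (Suc N) < e"
      using reals_Archimedean by (auto simp: inverse_eq_divide)
    show "\<exists>M. \<forall>m\<ge>M. \<forall>n\<ge>M. dist (trunc m y s w) (trunc n y s w) < e"
      using trunc_close[OF y, of N] N unfolding dist_real_def by (meson order_le_less_trans)
  qed
  then show ?thesis
    unfolding orbit_point_def by (simp add: Cauchy_convergent convergent_LIMSEQ_iff[symmetric])
qed

lemma trunc_point_close: "y \<in> K \<Longrightarrow> n \<ge> r N \<Longrightarrow> \<bar>trunc n y s w - point y s w\<bar> \<le> 1 / real (Suc N)"
proof (rule LIMSEQ_le_const2)
  assume y: "y \<in> K" "n \<ge> r N"
  show "(\<lambda>m. \<bar>trunc n y s w - trunc m y s w\<bar>) \<longlonglongrightarrow> \<bar>trunc n y s w - point y s w\<bar>"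
    by (intro tendsto_intros trunc_LIMSEQ y)
  show "\<exists>M. \<forall>m\<ge>M. \<bar>trunc n y s w - trunc m y s w\<bar> \<le> 1 / real (Suc N)"
    using trunc_close y by blast
qed

lemma point_in_interval: "y \<in> K \<Longrightarrow> point y s w \<in> {a..b}"
  using closed_sequentially[OF closed_atLeastAtMost _ trunc_LIMSEQ] trunc_in_interval by blast

text \<open>One step of the clock changes the block length by one and hence the matching cutoff. The
  shifts \<open>p\<close> and \<open>q\<close> compensate for this and vanish in the limit.\<close>

lemma H_point:
  assumes y: "y \<in> K" and step: "\<And>n. trunc (n + p) y s' w' = H (trunc (n + q) y s w)"
  shows "H (point y s w) = point y s' w'"
proof -
  have "(\<lambda>n. trunc (n + q) y s w) \<longlonglongrightarrow> point y s w" "(\<lambda>n. trunc (n + p) y s' w') \<longlonglongrightarrow> point y s' w'"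
    using LIMSEQ_ignore_initial_segment[OF trunc_LIMSEQ[OF y]] by blast+
  moreover have "(\<lambda>n. H (trunc (n + q) y s w)) \<longlonglongrightarrow> H (point y s w)"
    by (intro continuous_on_tendsto_compose[OF cont] calculation(1) always_eventually allI
        point_in_interval trunc_in_interval y)
  ultimately show ?thesis
    unfolding step using LIMSEQ_unique by blast
qed

text \<open>Dropping a 0 raises the negative time by one. If it was the last 0 of the block, control
  passes to the output tape, where the pushed 0 shows time 0.\<close>

lemma H_point_read:
  assumes y: "y \<in> K" and "s 0 = 0"
  shows "H (point y s w) = point y (\<lambda>i. s (Suc i)) (case_nat 0 w)"
proof (rule H_point[OF y, of 0 _ _ 1])
  fix n
  have "y \<in> {a..b}"
    using y compact(3) by blast
  moreover have "(Hi ^^ m) y \<in> {a..b}" for m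
    by (rule inv.funpow_in_interval) fact
  ultimately show "trunc (n + 0) y (\<lambda>i. s (Suc i)) (case_nat 0 w) = H (trunc (n + 1) y s w)"
    using assms(2) by (simp add: truncated_orbit_def lead_eq_0 H_Hi del: atLeastAtMost_iff)
qed

lemma H_point_write:
  assumes y: "y \<in> K" and "s 0 \<noteq> 0"
  shows "H (point y s w) = point y s (case_nat 1 w)"
  using assms(2) by (intro H_point[OF y, of 1 _ _ 0]) (simp add: truncated_orbit_def)

text \<open>The truncation error is uniform over \<open>K\<close> and all tapes, while a truncation
  depends on a finite prefix and on finitely many continuous iterates; each of three errors is below
  \<open>e / 3\<close>.\<close>

lemma point_continuous:
  assumes y: "y \<in> K" and "e > 0"
  shows "\<exists>d>0. \<exists>n. \<forall>y'\<in>K. \<bar>y - y'\<bar> < d \<longrightarrow>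
    (\<forall>s' w'. (\<forall>i<n. s i = s' i \<and> w i = w' i) \<longrightarrow> \<bar>point y s w - point y' s' w'\<bar> < e)"
proof -
  obtain N where N: "1 / real (Suc N) < e / 3"
    using reals_Archimedean[of "e / 3"] assms(2) by (auto simp: inverse_eq_divide)
  \<comment> \<open>\<open>Suc\<close> makes the prefix nonempty, so that it includes
    \<open>s 0\<close>, which selects the branch.\<close>
  define n where "n = Suc (r N)"
  have yab: "y \<in> {a..b}"
    using y compact(3) by blast
  have near: "\<forall>\<^sub>F y' in at y within {a..b}. \<bar>(f ^^ j) y' - (f ^^ j) y\<bar> < e / 3"
    if "continuous_on {a..b} (f ^^ j)" for f j
    using that yab assms(2) unfolding continuous_on_def tendsto_iff dist_real_def by (meson divide_pos_pos zero_less_numeral)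
  have "\<forall>\<^sub>F y' in at y within {a..b}. \<forall>j\<in>{..n}.
      \<bar>(H ^^ j) y' - (H ^^ j) y\<bar> < e / 3 \<and> \<bar>(Hi ^^ j) y' - (Hi ^^ j) y\<bar> < e / 3"
    by (intro eventually_ball_finite ballI eventually_conj near continuous_on_funpow inv.continuous_on_funpow) simp
  then obtain d where d: "d > 0" "\<And>y' j. y' \<in> {a..b} \<Longrightarrow> y' \<noteq> y \<Longrightarrow> dist y' y < d \<Longrightarrow> j \<le> n \<Longrightarrow>
      \<bar>(H ^^ j) y' - (H ^^ j) y\<bar> < e / 3 \<and> \<bar>(Hi ^^ j) y' - (Hi ^^ j) y\<bar> < e / 3"
    unfolding eventually_at by (meson atMost_iff)
  have "\<bar>point y s w - point y' s' w'\<bar> < e"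
    if "y' \<in> K" "\<bar>y - y'\<bar> < d" "\<forall>i<n. s i = s' i \<and> w i = w' i" for y' s' w'
  proof -
    have "lead 0 n s = lead 0 n s'" "lead 1 n w = lead 1 n w'" "s 0 = s' 0"
      using that(3) by (auto intro!: lead_cong simp: n_def)
    moreover have "y' \<in> {a..b}"
      using that(1) compact(3) by blast
    moreover have "\<bar>(H ^^ j) y' - (H ^^ j) y\<bar> < e / 3 \<and> \<bar>(Hi ^^ j) y' - (Hi ^^ j) y\<bar> < e / 3" if "j \<le> n" for j
      using d(2)[of y' j] that \<open>y' \<in> {a..b}\<close> \<open>\<bar>y - y'\<bar> < d\<close> assms(2)
      by (cases "y' = y") (auto simp: dist_real_def)
    ultimately have "\<bar>trunc n y' s' w' - trunc n y s w\<bar> < e / 3"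
      unfolding truncated_orbit_def using lead_le[of 0 n s'] lead_le[of 1 n w'] by simp
    moreover have "\<bar>trunc n y s w - point y s w\<bar> < e / 3" "\<bar>trunc n y' s' w' - point y' s' w'\<bar> < e / 3"
      using trunc_point_close[OF y, of N n s w] trunc_point_close[OF that(1), of N n s' w'] N
      by (simp_all add: n_def)
    ultimately show ?thesis
      by linarith
  qed
  then show ?thesis
    using d(1) by blast
qed

lemma point_surj:
  assumes "x \<in> {a..b}"
  shows "\<exists>y\<in>K. \<exists>s w. range s \<subseteq> {0, 1} \<and> range w \<subseteq> {0, 1} \<and> point y s w = x"
proof -
  obtain y j where y: "y \<in> K" "x = (H ^^ j) y \<or> x = (Hi ^^ j) y"
    using covers[OF assms] by blast
  have eqI: "point y s w = x" if "\<And>n. n \<ge> j \<Longrightarrow> trunc n y s w = x" for s w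
  proof (rule LIMSEQ_unique[OF trunc_LIMSEQ[OF y(1)]])
    show "(\<lambda>n. trunc n y s w) \<longlonglongrightarrow> x"
      using that by (intro tendsto_eventually) (auto simp: eventually_sequentially)
  qed
  from y(2) show ?thesis
  proof
    assume "x = (H ^^ j) y"
    then have "point y (\<lambda>_. 1) (\<lambda>i. if i < j then 1 else 0) = x"
      by (intro eqI) (simp add: truncated_orbit_def lead_block del: One_nat_def)
    then show ?thesis
      using y(1) by (intro bexI[of _ y] exI[of _ "\<lambda>_. 1"] exI[of _ "\<lambda>i. if i < j then 1 else 0"]) auto
  next
    assume "x = (Hi ^^ j) y"
    \<comment> \<open>For \<open>j = 0\<close> the input head is 1 and the zero output tape shows
      time 0, so the same code covers this case.\<close>
    then have "point y (\<lambda>i. if i < j then 0 else 1) (\<lambda>_. 0) = x"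
      by (intro eqI) (auto simp: truncated_orbit_def lead_block lead_eq_0)
    then show ?thesis
      using y(1) by (intro bexI[of _ y] exI[of _ "\<lambda>i. if i < j then 0 else 1"] exI[of _ "\<lambda>_. 0"]) auto
  qed
qed

end


section \<open>Rational rotation numbers and finite automata\<close>

lemma funpow_factor:
  assumes "dynamical_system X f" "\<And>x. x \<in> mspace X \<Longrightarrow> g (\<phi> x) = \<phi> (f x)" "x \<in> mspace X"
  shows "(f ^^ n) x \<in> mspace X \<and> (g ^^ n) (\<phi> x) = \<phi> ((f ^^ n) x)"
proof (induction n)
  case (Suc n)
  have "f ` mspace X \<subseteq> mspace X"
    using assms(1) continuous_map_image_subset_topspace unfolding dynamical_system_def by fastforce
  then show ?case
    using Suc assms(2) by auto
qed (use assms in simp)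

text \<open>The image of a periodic configuration is periodic; a point of \<open>Y\<close>
  guarantees that there is a configuration to start from.\<close>

lemma periodic_point_of_factor:
  assumes "factor_of_finite_automaton Y g" "mspace Y \<noteq> {}"
  obtains y p where "y \<in> mspace Y" "p > 0" "(g ^^ p) y = y"
proof -
  obtain T :: "nat set" and A :: "nat \<Rightarrow> nat set" and F
    where aut: "finite_automaton T A F" and factor: "is_factor Y g (config_metric T A) (automaton_map T F)"
    using assms(1) by (auto simp: factor_of_finite_automaton_def)
  have fin: "finite T"
    using aut by (simp add: finite_automaton_def automaton_def)
  obtain \<phi> where dyn: "dynamical_system (config_metric T A) (automaton_map T F)"
    and \<phi>: "\<phi> ` configs T A = mspace Y"
      "\<And>u. u \<in> mspace (config_metric T A) \<Longrightarrow> g (\<phi> u) = \<phi> (automaton_map T F u)"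
    using factor fin by (auto simp: is_factor_def mspace_config_metric)
  have "configs T A \<noteq> {}"
    using assms(2) \<phi>(1) by auto
  then obtain v p where v: "v \<in> configs T A" "p > 0" "(automaton_map T F ^^ p) v = v"
    using finite_automaton_periodic[OF aut] by metis
  have "(g ^^ p) (\<phi> v) = \<phi> v"
    using funpow_factor[of _ _ g \<phi> v p, OF dyn \<phi>(2)] v fin by (simp add: mspace_config_metric)
  then show ?thesis
    using that[of "\<phi> v" p] v \<phi>(1) by blast
qed

lemma periodic_point_of_lift:
  assumes "is_lift G g" "z \<in> unit_circle" "(g ^^ q) z = z"
  shows "\<exists>p x. (G ^^ q) x = x + of_int p"
proof -
  obtain x where x: "circle_proj x = z"
    using circle_proj_surj[OF assms(2)] by metis
  then have "circle_proj ((G ^^ q) x) = circle_proj x"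
    using lift_funpow[OF assms(1), of q x] assms(3) by simp
  then obtain p where "(G ^^ q) x - x = of_int p"
    unfolding circle_proj_eq_iff by (auto elim: Ints_cases)
  then have "(G ^^ q) x = x + of_int p"
    by simp
  then show ?thesis
    by blast
qed

text \<open>Tape 0 is never touched and codes a point of \<open>K\<close>, tape 1 is a cyclic counter, and the pair of
  input tape 2 and output tape 3 is a clock that ticks whenever the counter overflows.\<close>

definition clock_alphabet :: "nat \<Rightarrow> nat \<Rightarrow> nat set" where
  "clock_alphabet q t = (if t = 1 then {..<q} else {0, 1})"

text \<open>The counter is the head of an output tape: its next value is pushed on top and the old
  values stay beneath.\<close>

definition clock_action :: "nat \<Rightarrow> nat \<Rightarrow> (nat \<Rightarrow> nat) \<Rightarrow> nat action" where
  "clock_action q t s =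
    (if t = 0 then Stay
     else if t = 1 then Push (if Suc (s 1) < q then Suc (s 1) else 0)
     else if Suc (s 1) < q then Stay
     else if t = 2 then (if s 2 = 0 then Drop else Stay)
     else Push (if s 2 = 0 then 0 else 1))"

abbreviation clock_tapes :: "nat set" where
  "clock_tapes \<equiv> {0, 1, 2, 3}"

lemma finite_automaton_clock:
  assumes "q > 0"
  shows "finite_automaton clock_tapes (clock_alphabet q) (clock_action q)"
  using assms
  by (auto simp: finite_automaton_def automaton_def input_tape_def output_tape_def
      clock_action_def clock_alphabet_def)

lemma clock_map:
  fixes q :: nat and u :: "nat \<Rightarrow> nat \<Rightarrow> nat"
  defines "v \<equiv> automaton_map clock_tapes (clock_action q) u"
  shows "v 0 = u 0"
    and "v 1 0 = (if Suc (u 1 0) < q then Suc (u 1 0) else 0)"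
    and "Suc (u 1 0) < q \<Longrightarrow> v 2 = u 2"
    and "Suc (u 1 0) < q \<Longrightarrow> v 3 = u 3"
    and "\<not> Suc (u 1 0) < q \<Longrightarrow> v 2 = (if u 2 0 = 0 then (\<lambda>i. u 2 (Suc i)) else u 2)"
    and "\<not> Suc (u 1 0) < q \<Longrightarrow> v 3 = case_nat (if u 2 0 = 0 then 0 else 1) (u 3)"
  unfolding v_def automaton_map_def by (simp_all add: clock_action_def head_def)

section \<open>The automaton built from a periodic orbit of the lift\<close>

lemma interval_homeo_lift_funpow:
  assumes "degree_one_map G" "(G ^^ q) x0 = x0 + of_int p"
  obtains Hi where "interval_homeo (\<lambda>x. (G ^^ q) x - of_int p) Hi x0 (x0 + 1)"
proof -
  interpret Gq: degree_one_map "G ^^ q"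
    using assms(1) by (rule degree_one_map.degree_one_funpow)
  define H where "H x = (G ^^ q) x - of_int p" for x
  have smono: "H x < H y \<longleftrightarrow> x < y" for x y
    using Gq.mono by (simp add: H_def strict_mono_less)
  have inj: "inj H"
    using smono by (metis injI linorder_neqE less_irrefl)
  have surj: "surj H"
    using Gq.surj unfolding H_def surj_def by (metis add_diff_cancel)
  have H_inv: "H (inv H x) = x" "inv H (H x) = x" for x
    using inj surj by (simp_all add: surj_f_inv_f)
  have smono_inv: "inv H x < inv H y \<longleftrightarrow> x < y" for x y
    using smono[of "inv H x" "inv H y"] H_inv by simp
  have ends: "H x0 = x0" "H (x0 + 1) = x0 + 1"
    using assms(2) Gq.add_1[of x0] by (simp_all add: H_def)
  have cont: "continuous_on {x0..x0 + 1} H"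
    unfolding H_def by (intro continuous_intros continuous_on_subset[OF Gq.cont]) auto
  have "H ` {x0..x0 + 1} = {x0..x0 + 1}"
  proof (intro subset_antisym subsetI)
    fix y assume "y \<in> {x0..x0 + 1}"
    then have "inv H y \<in> {x0..x0 + 1}"
      using smono[of "inv H y" x0] smono[of "x0 + 1" "inv H y"] H_inv ends by (auto simp: not_less[symmetric])
    then show "y \<in> H ` {x0..x0 + 1}"
      using H_inv(1) by (metis imageI)
  next
    fix y assume "y \<in> H ` {x0..x0 + 1}"
    then obtain x where "x \<in> {x0..x0 + 1}" "y = H x"
      by blast
    then show "y \<in> {x0..x0 + 1}"
      using smono[of x x0] smono[of "x0 + 1" x] ends by (auto simp: not_less[symmetric])
  qed
  then have cont_inv: "continuous_on {x0..x0 + 1} (inv H)"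
    using continuous_on_inv[OF cont compact_Icc, of "inv H"] H_inv by simp
  have "interval_homeo H (inv H) x0 (x0 + 1)"
  proof
    show "H x \<le> H y" "inv H x \<le> inv H y" if "x \<le> y" for x y
      using smono[of y x] smono_inv[of y x] that by (auto simp: not_less[symmetric])
    show "inv H x0 = x0" "inv H (x0 + 1) = x0 + 1"
      using H_inv(2) ends by metis+
  qed (use cont cont_inv ends H_inv in auto)
  then show ?thesis
    using that unfolding H_def by blast
qed

text \<open>The factor map projects \<open>(G ^^ k) (\<Phi> u)\<close>, where \<open>k\<close> is
  the counter and \<open>\<Phi> u\<close> the interval point shown by the clock. Each count applies
  \<open>G\<close> once, and an overflow trades \<open>q\<close> counts for one step of
  \<open>H\<close>.\<close>

lemma factor_of_clock:
  assumes lift: "is_lift G g" and "dynamical_system circle_metric g"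
    and q: "q > 0"
    and orbits: "uniform_orbits (\<lambda>x. (G ^^ q) x - of_int p) Hi x0 (x0 + 1) K r"
  shows "is_factor circle_metric g (config_metric clock_tapes (clock_alphabet q))
    (automaton_map clock_tapes (clock_action q))"
proof -
  define H where "H = (\<lambda>x. (G ^^ q) x - of_int p)"
  interpret uniform_orbits H Hi x0 "x0 + 1" K r
    using orbits by (simp only: H_def)
  let ?X = "configs clock_tapes (clock_alphabet q)"
  define \<Phi> where "\<Phi> u = point (decode K (u 0)) (u 2) (u 3)" for u :: "nat \<Rightarrow> nat \<Rightarrow> nat"
  define \<phi> where "\<phi> u = circle_proj ((G ^^ u 1 0) (\<Phi> u))" for u :: "nat \<Rightarrow> nat \<Rightarrow> nat"
  have into: "\<phi> u \<in> unit_circle" for u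
    by (simp add: \<phi>_def)
  have decode: "decode K c \<in> K" for c
    by (rule decode_in[OF compact(1,2)])
  have H_\<Phi>: "H (\<Phi> u) = \<Phi> (automaton_map clock_tapes (clock_action q) u)" if "\<not> Suc (u 1 0) < q" for u
    using H_point_read[OF decode, of "u 2" "u 0" "u 3"] H_point_write[OF decode, of "u 2" "u 0" "u 3"]
    using clock_map(5)[of u q, OF that] clock_map(6)[of u q, OF that]
    unfolding \<Phi>_def clock_map(1) by (cases "u 2 0 = 0") simp_all
  have g_\<phi>: "g (\<phi> u) = circle_proj ((G ^^ Suc (u 1 0)) (\<Phi> u))" for u
    using lift by (simp add: \<phi>_def is_lift_def)
  have semiconj: "g (\<phi> u) = \<phi> (automaton_map clock_tapes (clock_action q) u)" if "u \<in> ?X" for u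
  proof (cases "Suc (u 1 0) < q")
    case True
    then have "\<phi> (automaton_map clock_tapes (clock_action q) u) = circle_proj ((G ^^ Suc (u 1 0)) (\<Phi> u))"
      by (simp add: \<phi>_def \<Phi>_def clock_map del: One_nat_def)
    then show ?thesis
      by (simp only: g_\<phi>)
  next
    case False
    have "u 1 \<in> UNIV \<rightarrow> clock_alphabet q 1"
      using that unfolding configs_def by (rule PiE_mem) simp
    then have "u 1 0 \<in> clock_alphabet q 1"
      by (rule funcset_mem) simp
    then have "Suc (u 1 0) = q"
      using False by (simp add: clock_alphabet_def)
    then have "g (\<phi> u) = circle_proj ((G ^^ q) (\<Phi> u))"
      using g_\<phi>[of u] by (simp only:)
    \<comment> \<open>\<open>H\<close> and \<open>G ^^ q\<close> differ by the integer
      \<open>p\<close>, which the projection does not see.\<close>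
    also have "\<dots> = circle_proj (H (\<Phi> u))"
      by (simp add: H_def circle_proj_eq_iff)
    also have "\<dots> = \<phi> (automaton_map clock_tapes (clock_action q) u)"
      unfolding H_\<Phi>[of u, OF False] \<phi>_def clock_map(2) using False by simp
    finally show ?thesis .
  qed
  have surj: "\<exists>u\<in>?X. \<phi> u = z" if z: "z \<in> unit_circle" for z
  proof -
    obtain x where x: "x0 \<le> x" "x \<le> x0 + 1" "circle_proj x = z"
      using circle_proj_surj[OF z] by metis
    then have "x \<in> {x0..x0 + 1}"
      by simp
    from point_surj[OF this]
    obtain y s w where ysw: "y \<in> K" "range s \<subseteq> {0, 1}" "range w \<subseteq> {0, 1}" "point y s w = x"
      by (elim bexE exE conjE)
    obtain c where c: "range c \<subseteq> {0, 1}" "decode K c = y"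
      using decode_surj[OF compact(1,2) ysw(1)] by (elim exE conjE)
    \<comment> \<open>With the counter at 0 the factor map just projects the clock point, and these
      points fill an interval of length 1.\<close>
    define u where "u = (\<lambda>t\<in>clock_tapes. if t = 0 then c else if t = 1 then (\<lambda>_. 0) else if t = 2 then s else w)"
    have "u \<in> ?X"
      unfolding u_def configs_def restrict_PiE_iff
      using c(1) ysw(2,3) q by (auto simp: clock_alphabet_def)
    moreover have "\<phi> u = z"
      using c(2) ysw(4) x(3) by (simp add: \<phi>_def \<Phi>_def u_def)
    ultimately show ?thesis
      by blast
  qed
  have \<Phi>_cont: "\<exists>n. \<forall>v\<in>?X. agree clock_tapes n u v \<longrightarrow> \<bar>\<Phi> u - \<Phi> v\<bar> < e"
    if "u \<in> ?X" and e: "e > 0" for u e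
  proof -
    from point_continuous[OF decode[of "u 0"] e, where s = "u 2" and w = "u 3"]
    obtain d n where d: "d > 0" "\<forall>y'\<in>K. \<bar>decode K (u 0) - y'\<bar> < d \<longrightarrow>
        (\<forall>s' w'. (\<forall>i<n. u 2 i = s' i \<and> u 3 i = w' i) \<longrightarrow>
          \<bar>point (decode K (u 0)) (u 2) (u 3) - point y' s' w'\<bar> < e)"
      by (elim exE conjE)
    from decode_continuous[OF compact(1,2) d(1)]
    obtain m where m: "\<forall>c c'. (\<forall>i<m. c i = c' i) \<longrightarrow> \<bar>decode K c - decode K c'\<bar> < d"
      by (elim exE)
    have "\<bar>\<Phi> u - \<Phi> v\<bar> < e" if "agree clock_tapes (max m n) u v" for v
    proof -
      have "\<forall>i<m. u 0 i = v 0 i" "\<forall>i<n. u 2 i = v 2 i \<and> u 3 i = v 3 i"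
        using that by (simp_all add: agree_def)
      then show ?thesis
        unfolding \<Phi>_def using d(2) m decode[of "v 0"] by simp
    qed
    then show ?thesis
      by blast
  qed
  have "continuous_map (mtopology_of (config_metric clock_tapes (clock_alphabet q))) (mtopology_of circle_metric) \<phi>"
  proof (rule continuous_map_config_metric)
    show "\<phi> ` ?X \<subseteq> mspace circle_metric"
      using into by (auto simp: circle_metric_def)
  next
    fix u and e :: real
    assume u: "u \<in> ?X" and "e > 0"
    define j where "j = u 1 0"
    have "continuous_on UNIV (\<lambda>x. circle_proj ((G ^^ j) x))"
    proof -
      have "continuous_on UNIV (G ^^ j)"
      proof (induction j)
        case (Suc j)
        then show ?case
          using lift continuous_on_compose[of UNIV "G ^^ j" G] continuous_on_subset[of UNIV G]
          by (simp add: is_lift_def)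
      qed (simp add: continuous_on_id)
      then show ?thesis
        using continuous_on_compose[of UNIV "G ^^ j" circle_proj] continuous_on_circle_proj
        by (simp add: o_def)
    qed
    then obtain d where d: "d > 0"
      "\<And>x. \<bar>x - \<Phi> u\<bar> < d \<Longrightarrow> dist (circle_proj ((G ^^ j) x)) (circle_proj ((G ^^ j) (\<Phi> u))) < e"
      using \<open>e > 0\<close> unfolding continuous_on_iff dist_real_def by (meson UNIV_I)
    obtain n where n: "\<And>v. v \<in> ?X \<Longrightarrow> agree clock_tapes n u v \<Longrightarrow> \<bar>\<Phi> u - \<Phi> v\<bar> < d"
      using \<Phi>_cont[OF u d(1)] by blast
    \<comment> \<open>\<open>Suc n\<close> makes the counters of \<open>u\<close> and
      \<open>v\<close> equal, so one iterate of \<open>G\<close> serves both.\<close>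
    have "mdist circle_metric (\<phi> u) (\<phi> v) < e" if v: "v \<in> ?X" "agree clock_tapes (Suc n) u v" for v
    proof -
      have "v 1 0 = j"
        using v(2) by (auto simp: agree_def j_def)
      moreover have "\<bar>\<Phi> v - \<Phi> u\<bar> < d"
        using n[OF v(1)] agree_mono[OF v(2), of n] by (simp add: abs_minus_commute)
      ultimately show ?thesis
        using d(2)[of "\<Phi> v"] by (simp add: circle_metric_def \<phi>_def j_def dist_commute del: One_nat_def)
    qed
    then show "\<exists>n. \<forall>v\<in>?X. agree clock_tapes n u v \<longrightarrow> mdist circle_metric (\<phi> u) (\<phi> v) < e"
      by blast
  qed simp
  moreover have "\<phi> ` ?X = unit_circle"
    using surj into by blast
  moreover have "dynamical_system (config_metric clock_tapes (clock_alphabet q)) (automaton_map clock_tapes (clock_action q))"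
    using finite_automaton_clock[OF q] by (intro dynamical_system_automaton) (simp add: finite_automaton_def)
  ultimately show ?thesis
    using assms(2) semiconj unfolding is_factor_def
    by (intro conjI exI[of _ \<phi>]) (simp_all add: mspace_config_metric circle_metric_def)
qed

theorem theorem3:
  fixes g :: "complex \<Rightarrow> complex"
  assumes "orientation_preserving_homeo g"
  shows "factor_of_finite_automaton circle_metric g \<longleftrightarrow> rotation_number g \<in> \<rat>"
proof -
  obtain G where G: "is_lift G g" "degree_one_map G"
    and rational: "rotation_number g \<in> \<rat> \<longleftrightarrow> (\<exists>q>0. \<exists>p x. (G ^^ q) x = x + of_int p)"
    using rotation_number_rational_iff[OF assms] by metis
  show ?thesis
  proof
    assume "factor_of_finite_automaton circle_metric g"
    then obtain z q where "z \<in> unit_circle" "q > 0" "(g ^^ q) z = z"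
      using periodic_point_of_factor[of circle_metric g] by (auto simp: circle_metric_def)
    then show "rotation_number g \<in> \<rat>"
      using periodic_point_of_lift[OF G(1)] rational by blast
  next
    assume "rotation_number g \<in> \<rat>"
    then obtain q p x0 where q: "q > 0" "(G ^^ q) x0 = x0 + of_int p"
      using rational by blast
    obtain Hi where "interval_homeo (\<lambda>x. (G ^^ q) x - of_int p) Hi x0 (x0 + 1)"
      using interval_homeo_lift_funpow[OF G(2) q(2)] by blast
    then interpret interval_homeo "\<lambda>x. (G ^^ q) x - of_int p" Hi x0 "x0 + 1" .
    obtain K r where "uniform_orbits (\<lambda>x. (G ^^ q) x - of_int p) Hi x0 (x0 + 1) K r"
    proof (rule uniform_orbit_representatives)
      fix K r
      assume "compact K" "K \<noteq> {}" "K \<subseteq> {x0..x0 + 1}"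
        "\<And>N y. y \<in> K \<Longrightarrow> tail_close (\<lambda>x. (G ^^ q) x - of_int p) y (r N) (1 / real (Suc N))"
        "\<And>N y. y \<in> K \<Longrightarrow> tail_close Hi y (r N) (1 / real (Suc N))"
        "\<And>x. x \<in> {x0..x0 + 1} \<Longrightarrow>
          \<exists>y\<in>K. \<exists>n. x = ((\<lambda>x. (G ^^ q) x - of_int p) ^^ n) y \<or> x = (Hi ^^ n) y"
      then show thesis
        by (intro that uniform_orbits.intro uniform_orbits_axioms.intro interval_homeo_axioms)
    qed
    moreover have "dynamical_system circle_metric g"
      using assms by (intro dynamical_system_circle) (auto simp: orientation_preserving_homeo_def homeomorphism_def)
    ultimately show "factor_of_finite_automaton circle_metric g"
      using factor_of_clock[OF G(1) _ q(1)] finite_automaton_clock[OF q(1)]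
      unfolding factor_of_finite_automaton_def by blast
  qed
qed

end
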